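(* Let $p$ be an even positive integer with $p\neq 2$, let $d$ be a positive integer, and let $(G,\boldsymbol p)$ be a generic $d$-dimensional framework with $n\ge 3$ vertices. If for every $k\in\{1,\dots,d\}$ the framework $(G,\boldsymbol p)$ has a $k$-th coordinated self-stress $\omega^k$ such that $\operatorname{rank}L_{G,\omega^k}=n-2$, then $(G,\boldsymbol p)$ is globally rigid in $\ell_p^d$.
   Context: Graphs are finite and simple. $\ell_p^d$ denotes $\mathbb{R}^d$ with distance $\|\boldsymbol x-\boldsymbol y\|_p=\left(\sum_{i=1}^d (x_i-y_i)^p\right)^{1/p}$ ($p$ even). A $d$-dimensional framework $(G,\boldsymbol p)$ is a graph $G=(V,E)$ with a map $\boldsymbol p:V\to\mathbb{R}^d$; it is generic if the $d|V|$ coordinates of $\boldsymbol p$ are algebraically independent over $\mathbb{Q}$. $(\boldsymbol x)_k$ is the $k$-th coordinate of $\boldsymbol x$, and powers $\boldsymbol x^m$ of vectors are taken coordinatewise. Two frameworks $(G,\boldsymbol p),(G,\boldsymbol q)$ in $\mathbb{R}^d$ are equivalent if $\|\boldsymbol p(i)-\boldsymbol p(j)\|_p=\|\boldsymbol q(i)-\boldsymbol q(j)\|_p$ for all $ij\in E(G)$, and congruent if there is an isometry $\iota$ of $\ell_p^d$ with $\boldsymbol q(i)=\iota(\boldsymbol p(i))$ for all $i\in V(G)$. (For $p\ne 2$ the isometries are the compositions of translations, permutations of coordinates and reflections along coordinate axes.) $(G,\boldsymbol p)$ is globally rigid in $\ell_p^d$ if every framework equivalent to it is congruent to it. A self-stress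 of $(G,\boldsymbol p)$ is a map $\omega:E(G)\to\mathbb{R}$ with $\sum_{j:ij\in E(G)}\omega(ij)(\boldsymbol p(j)-\boldsymbol p(i))^{p-1}=0$ for every $i\in V(G)$. For $k\in\{1,\dots,d\}$, a $k$-th coordinated self-stress of $(G,\boldsymbol p)$ is a map $\omega^k:E(G)\to\mathbb{R}$ of the form $\omega^k(ij)=\omega(ij)\left((\boldsymbol p(j))_k-(\boldsymbol p(i))_k\right)^{p-2}$ for some self-stress $\omega$ of $(G,\boldsymbol p)$. For an edge weight $\omega:E(G)\to\mathbb{R}$, the weighted Laplacian $L_{G,\omega}$ is the symmetric $V\times V$ matrix with diagonal entries $L_{G,\omega}[i,i]=\sum_{j:ij\in E(G)}\omega(ij)$ and off-diagonal entries $-\omega(ij)$ if $ij\in E(G)$ and $0$ otherwise. *)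

theory Defs
  imports "HOL-Analysis.Analysis" "HOL-Library.Poly_Mapping"
begin

text \<open>
  A graph is given by its set \<open>E\<close> of edges, which are two-element subsets of a finite vertex
  type \<open>'v\<close>; the vertex set is the whole type. A framework is \<open>E\<close> together with a map
  \<open>x :: 'v \<Rightarrow> real ^ 'd\<close>, so \<open>d = CARD('d)\<close>. The letter \<open>p\<close> always denotes the exponent of the norm.
  Edge weights are functions on \<open>'v set\<close>, of which only the values on \<open>E\<close> are ever used.
\<close>

definition simple_graph :: "'v::finite set set \<Rightarrow> bool" where
  "simple_graph E \<longleftrightarrow> (\<forall>e\<in>E. card e = 2)"

definition neighbours :: "'v::finite set set \<Rightarrow> 'v \<Rightarrow> 'v set" where
  "neighbours E i = {j. {i, j} \<in> E}"

text \<open>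
  Multivariate polynomials over \<open>rat\<close> in variables indexed by \<open>'i\<close> are finitely supported maps from
  monomials (finitely supported exponent maps) to coefficients.
\<close>

definition eval_rat_mpoly :: "('i \<Rightarrow> real) \<Rightarrow> (('i \<Rightarrow>\<^sub>0 nat) \<Rightarrow>\<^sub>0 rat) \<Rightarrow> real" where
  "eval_rat_mpoly a f =
     (\<Sum>m\<in>Poly_Mapping.keys f. of_rat (Poly_Mapping.lookup f m) *
        (\<Prod>i\<in>Poly_Mapping.keys m. a i ^ Poly_Mapping.lookup m i))"

definition algebraically_independent_rat :: "('i \<Rightarrow> real) \<Rightarrow> bool" where
  "algebraically_independent_rat a \<longleftrightarrow> (\<forall>f. eval_rat_mpoly a f = 0 \<longrightarrow> f = 0)"

definition generic :: "('v::finite \<Rightarrow> real ^ 'd) \<Rightarrow> bool" where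
  "generic x \<longleftrightarrow> algebraically_independent_rat (\<lambda>(i, k). x i $ k)"

definition lp_dist :: "nat \<Rightarrow> real ^ 'd \<Rightarrow> real ^ 'd \<Rightarrow> real" where
  "lp_dist p u v = root p (\<Sum>k\<in>UNIV. (u $ k - v $ k) ^ p)"

definition lp_isometry :: "nat \<Rightarrow> (real ^ 'd \<Rightarrow> real ^ 'd) \<Rightarrow> bool" where
  "lp_isometry p \<iota> \<longleftrightarrow> bij \<iota> \<and> (\<forall>u v. lp_dist p (\<iota> u) (\<iota> v) = lp_dist p u v)"

definition equivalent_frameworks ::
  "nat \<Rightarrow> 'v::finite set set \<Rightarrow> ('v \<Rightarrow> real ^ 'd) \<Rightarrow> ('v \<Rightarrow> real ^ 'd) \<Rightarrow> bool" where
  "equivalent_frameworks p E x y \<longleftrightarrow>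
     (\<forall>i j. {i, j} \<in> E \<longrightarrow> lp_dist p (x i) (x j) = lp_dist p (y i) (y j))"

definition congruent_frameworks ::
  "nat \<Rightarrow> ('v::finite \<Rightarrow> real ^ 'd) \<Rightarrow> ('v \<Rightarrow> real ^ 'd) \<Rightarrow> bool" where
  "congruent_frameworks p x y \<longleftrightarrow> (\<exists>\<iota>. lp_isometry p \<iota> \<and> (\<forall>i. y i = \<iota> (x i)))"

definition globally_rigid :: "nat \<Rightarrow> 'v::finite set set \<Rightarrow> ('v \<Rightarrow> real ^ 'd) \<Rightarrow> bool" where
  "globally_rigid p E x \<longleftrightarrow>
     (\<forall>y. equivalent_frameworks p E x y \<longrightarrow> congruent_frameworks p x y)"

definition coord_power :: "real ^ 'd \<Rightarrow> nat \<Rightarrow> real ^ 'd" where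
  "coord_power u m = (\<chi> k. (u $ k) ^ m)"

definition self_stress ::
  "nat \<Rightarrow> 'v::finite set set \<Rightarrow> ('v \<Rightarrow> real ^ 'd) \<Rightarrow> ('v set \<Rightarrow> real) \<Rightarrow> bool" where
  "self_stress p E x \<omega> \<longleftrightarrow>
     (\<forall>i. (\<Sum>j\<in>neighbours E i. \<omega> {i, j} *\<^sub>R coord_power (x j - x i) (p - 1)) = 0)"

text \<open>For even \<open>p\<close> the right-hand side below is symmetric in \<open>i\<close> and \<open>j\<close>.\<close>

definition coordinated_self_stress ::
  "nat \<Rightarrow> 'v::finite set set \<Rightarrow> ('v \<Rightarrow> real ^ 'd) \<Rightarrow> 'd \<Rightarrow> ('v set \<Rightarrow> real) \<Rightarrow> bool" where
  "coordinated_self_stress p E x k \<omega>k \<longleftrightarrow>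
     (\<exists>\<omega>. self_stress p E x \<omega> \<and>
        (\<forall>i j. {i, j} \<in> E \<longrightarrow> \<omega>k {i, j} = \<omega> {i, j} * (x j $ k - x i $ k) ^ (p - 2)))"

definition weighted_laplacian ::
  "'v::finite set set \<Rightarrow> ('v set \<Rightarrow> real) \<Rightarrow> real ^ 'v ^ 'v" where
  "weighted_laplacian E \<omega> =
     (\<chi> i j. if i = j then (\<Sum>l\<in>neighbours E i. \<omega> {i, l})
             else if {i, j} \<in> E then - \<omega> {i, j} else 0)"

end

theory Submission
  imports Defs "HOL-Computational_Algebra.Polynomial"
begin

text \<open>
  Write \<open>X\<^sub>1, \<dots>, X\<^sub>d\<close> for the coordinates of the given framework, as functions on the vertices, and \<open>f(q)\<close>
  for the vector \<open>((q\<^sub>j - q\<^sub>i)\<^sup>p)\<^sub>i\<^sub>j\<close> indexed by the edges. An equivalent framework with coordinates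
  \<open>Y\<^sub>1, \<dots>, Y\<^sub>d\<close> satisfies \<open>f(Y\<^sub>1) + \<dots> + f(Y\<^sub>d) = f(X\<^sub>1) + \<dots> + f(X\<^sub>d)\<close>. The claim is that this
  decomposition is unique up to order and that \<open>f(Y) = f(X\<^sub>l)\<close> determines \<open>Y\<close> up to sign and translation.

  The coordinates of a generic framework are algebraically independent, so derivations of the field of
  real numbers can move them in any direction (\<open>algebraically_independent_derivation\<close>). All other numbers
  in play, such as the coordinates \<open>Y\<close> or the coefficients of a linear relation, are then differentiated along
  with it. This replaces deformations of the framework and
  algebraic geometry by formal computations with derivations, which are available on all of the reals because
  derivations of fields of characteristic \<open>0\<close> extend (\<open>derivation_extends\<close>).

  The main tool is to differentiate an identity between tangent vectors of \<open>f\<close> and to pair it with a stress. As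
  stresses annihilate tangent vectors, only second derivatives of \<open>f\<close> survive, and these
  are the Laplacians of the coordinated stresses (\<open>differentiated_edge_identity\<close>). Their kernels are spanned by
  the constants and \<open>X\<^sub>l\<close> because of the rank hypothesis, so the conclusions are always that
  something is affine in \<open>X\<^sub>l\<close> (\<open>contact_vectors_affine\<close>). In this way the vectors \<open>f(X\<^sub>l)\<close> turn out to be
  linearly independent and the framework infinitesimally rigid. By a dimension count \<open>X\<close> and \<open>Y\<close> then have the
  same tangent vectors and thus the same stresses (\<open>tangent_space_contained\<close>, \<open>stress_transfers\<close>), and the
  tool applied once more gives \<open>f(Y\<^sub>k) = \<Sum>\<^sub>l b\<^sub>k\<^sub>l f(X\<^sub>l)\<close> (\<open>coordinate_lengths_combination\<close>).

  If two coefficients in such a combination were nonzero, then \<open>Y\<^sub>k\<close> would have to follow independent motions of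
  two coordinates \<open>X\<^sub>l\<close>, for which it has too few degrees of freedom as there are at least three vertices
  (\<open>at_most_one_coefficient\<close>). Hence \<open>f(Y\<^sub>k) = f(X\<^sub>l)\<close> after a permutation of the coordinates
  (\<open>coordinate_matching\<close>). Then \<open>Y\<^sub>k\<close> lies in the kernel of the Laplacian at \<open>X\<^sub>l\<close> and is
  \<open>\<plusminus>X\<^sub>l\<close> plus a constant (\<open>coordinates_agree_up_to_sign\<close>).
\<close>

section \<open>Extending derivations of fields\<close>

definition derivation :: "('a::comm_ring \<Rightarrow> 'a) \<Rightarrow> bool" where
  "derivation D \<longleftrightarrow> (\<forall>a b. D (a + b) = D a + D b) \<and> (\<forall>a b. D (a * b) = D a * b + a * D b)"

text \<open>
  Dual numbers \<open>a + b\<epsilon>\<close> with \<open>\<epsilon>\<^sup>2 = 0\<close>. A map \<open>D\<close> is a derivation exactly when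
  \<open>a \<mapsto> a + D a \<epsilon>\<close> is a ring homomorphism, so working with dual numbers turns the Leibniz rule into
  closure under multiplication.
\<close>

datatype 'a dual = Dual (base: 'a) (tangent: 'a)

instantiation dual :: (comm_ring_1) comm_ring_1
begin
definition "0 = Dual 0 0"
definition "1 = Dual 1 0"
definition "a + b = Dual (base a + base b) (tangent a + tangent b)"
definition "a - b = Dual (base a - base b) (tangent a - tangent b)"
definition "- a = Dual (- base a) (- tangent a)"
definition "a * b = Dual (base a * base b) (tangent a * base b + base a * tangent b)"
instance
  by standard
    (auto simp: zero_dual_def one_dual_def plus_dual_def minus_dual_def uminus_dual_def
      times_dual_def algebra_simps)
end

lemma dual_simps [simp]:
  "base 0 = 0" "tangent 0 = 0" "base 1 = 1" "tangent 1 = 0"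
  "base (a + b) = base a + base b" "tangent (a + b) = tangent a + tangent b"
  "base (a - b) = base a - base b" "tangent (a - b) = tangent a - tangent b"
  "base (- a) = - base a" "tangent (- a) = - tangent a"
  "base (a * b) = base a * base b" "tangent (a * b) = tangent a * base b + base a * tangent b"
  by (simp_all add: zero_dual_def one_dual_def plus_dual_def minus_dual_def uminus_dual_def
      times_dual_def)

lemma base_poly: "base (poly Q \<beta>) = poly (map_poly base Q) (base \<beta>)"
  by (induction Q) (auto simp: map_poly_pCons)

text \<open>
  The first-order Taylor expansion of a polynomial at \<open>b\<close>. It is exact because \<open>\<epsilon>\<^sup>2 = 0\<close>; the
  coefficients may themselves have infinitesimal parts, which are multiplied by \<open>\<epsilon>\<close> and vanish
  in the second summand.
\<close>

lemma poly_Dual: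
  fixes Q :: "'a::idom dual poly"
  shows "poly Q (Dual b u) =
    poly Q (Dual b 0) + Dual 0 (u * poly (pderiv (map_poly base Q)) b)"
proof (induction Q)
  case (pCons c Q)
  have "poly (pCons c Q) (Dual b u) =
      c + Dual b u * (poly Q (Dual b 0) + Dual 0 (u * poly (pderiv (map_poly base Q)) b))"
    using pCons.IH by simp
  also have "\<dots> = poly (pCons c Q) (Dual b 0) + Dual 0 (u * poly (pderiv (map_poly base (pCons c Q))) b)"
    by (rule dual.expand) (simp add: map_poly_pCons pderiv_pCons base_poly algebra_simps)
  finally show ?case .
qed (simp add: zero_dual_def[symmetric])

definition is_subring :: "'a::comm_ring_1 set \<Rightarrow> bool" where
  "is_subring S \<longleftrightarrow> 1 \<in> S \<and> (\<forall>a\<in>S. \<forall>b\<in>S. a - b \<in> S \<and> a * b \<in> S)"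

lemma is_subringD:
  assumes "is_subring S"
  shows "1 \<in> S" "0 \<in> S" "a \<in> S \<Longrightarrow> b \<in> S \<Longrightarrow> a - b \<in> S" "a \<in> S \<Longrightarrow> b \<in> S \<Longrightarrow> a * b \<in> S"
    "a \<in> S \<Longrightarrow> b \<in> S \<Longrightarrow> a + b \<in> S"
proof -
  show *: "1 \<in> S" "a \<in> S \<Longrightarrow> b \<in> S \<Longrightarrow> a - b \<in> S" "a \<in> S \<Longrightarrow> b \<in> S \<Longrightarrow> a * b \<in> S" for a b
    using assms by (auto simp: is_subring_def)
  show 0: "0 \<in> S" using *(2)[OF *(1) *(1)] by simp
  show "a + b \<in> S" if "a \<in> S" "b \<in> S" using *(2)[OF that(1) *(2)[OF 0 that(2)]] by simp
qed

lemma is_subring_sum: "is_subring S \<Longrightarrow> (\<And>i. i \<in> I \<Longrightarrow> f i \<in> S) \<Longrightarrow> sum f I \<in> S"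
  by (induction I rule: infinite_finite_induct) (auto intro: is_subringD)

lemma is_subring_of_nat: "is_subring S \<Longrightarrow> of_nat n \<in> S"
  by (induction n) (auto intro: is_subringD)

text \<open>
  The graphs \<open>{a + D a \<epsilon>}\<close> of derivations \<open>D\<close> defined on a subring and with values in the whole
  ring. The second condition says that \<open>D\<close> is single-valued; by subtraction it suffices to state it
  at \<open>0\<close>.
\<close>

definition derivation_graph :: "'a::comm_ring_1 dual set \<Rightarrow> bool" where
  "derivation_graph G \<longleftrightarrow> is_subring G \<and> (\<forall>a\<in>G. base a = 0 \<longrightarrow> a = 0)"

definition polys_over :: "'a::zero set \<Rightarrow> 'a poly set" where
  "polys_over S = {Q. \<forall>i. coeff Q i \<in> S}"

lemma is_subring_adjoin:
  fixes S :: "'a::comm_ring_1 set"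
  assumes S: "is_subring S"
  shows "is_subring ((\<lambda>Q. poly Q \<beta>) ` polys_over S)"
  unfolding is_subring_def
proof (intro conjI ballI)
  have "1 \<in> polys_over S"
    using is_subringD[OF S] by (auto simp: polys_over_def one_pCons coeff_pCons split: nat.splits)
  then show "1 \<in> (\<lambda>Q. poly Q \<beta>) ` polys_over S" by (rule rev_image_eqI) simp
next
  fix a b assume "a \<in> (\<lambda>Q. poly Q \<beta>) ` polys_over S" "b \<in> (\<lambda>Q. poly Q \<beta>) ` polys_over S"
  then obtain P Q where PQ: "a = poly P \<beta>" "b = poly Q \<beta>" "P \<in> polys_over S" "Q \<in> polys_over S"
    by auto
  then have "P - Q \<in> polys_over S" "P * Q \<in> polys_over S"
    using is_subringD[OF S] by (auto simp: polys_over_def coeff_mult intro!: is_subring_sum[OF S])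
  then show "a - b \<in> (\<lambda>Q. poly Q \<beta>) ` polys_over S" "a * b \<in> (\<lambda>Q. poly Q \<beta>) ` polys_over S"
    unfolding PQ by (metis poly_diff imageI, metis poly_mult imageI)
qed

text \<open>
  A derivation extends to one further element \<open>b\<close>. If \<open>b\<close> is transcendental over the domain, its
  derivative can be anything. Otherwise let \<open>m\<close> be a nonzero polynomial of least degree over the
  domain that vanishes at \<open>b\<close>. In characteristic \<open>0\<close> its derivative does not vanish at \<open>b\<close>, so the
  equation that differentiating \<open>m(b) = 0\<close> imposes on the derivative \<open>u\<close> of \<open>b\<close> can be solved. Every
  other relation satisfied by \<open>b\<close> then has derivative \<open>0\<close> as well, by division with remainder by \<open>m\<close>.
  The argument never divides within the domain, so a subring is enough.
\<close>

lemma derivation_graph_adjoin: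
  fixes G :: "'a::field_char_0 dual set" and b :: 'a
  assumes G: "derivation_graph G"
  shows "\<exists>u. \<forall>Q\<in>polys_over G. base (poly Q (Dual b u)) = 0 \<longrightarrow> poly Q (Dual b u) = 0"
proof -
  have sub: "is_subring G" and sv: "\<And>a. a \<in> G \<Longrightarrow> base a = 0 \<Longrightarrow> a = 0"
    using G by (auto simp: derivation_graph_def)
  have base_coeff: "coeff (map_poly base Q) i = base (coeff Q i)" for Q :: "'a dual poly" and i
    by (simp add: coeff_map_poly)
  have base_in: "map_poly base Q \<in> polys_over (base ` G)" if "Q \<in> polys_over G" for Q
    using that by (auto simp: polys_over_def base_coeff)
  have base_0: "Q = 0" if "Q \<in> polys_over G" "map_poly base Q = 0" for Q
    using that sv by (intro poly_eqI) (metis (mono_tags) base_coeff coeff_0 mem_Collect_eq polys_over_def)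
  define Z where "Z = {q \<in> polys_over (base ` G). q \<noteq> 0 \<and> poly q b = 0}"
  show ?thesis
  proof (cases "Z = {}")
    case True
    have "poly Q (Dual b 0) = 0" if "Q \<in> polys_over G" "base (poly Q (Dual b 0)) = 0" for Q
    proof -
      have "map_poly base Q = 0"
        using that True base_in[of Q] by (auto simp: Z_def base_poly)
      then show ?thesis using base_0[OF that(1)] by simp
    qed
    then show ?thesis by blast
  next
    case False
    define m where "m = arg_min degree (\<lambda>q. q \<in> Z)"
    have m: "m \<in> Z" and min: "\<And>q. q \<in> Z \<Longrightarrow> degree m \<le> degree q"
      using False arg_min_nat_lemma[of "\<lambda>q. q \<in> Z" _ degree] unfolding m_def by blast+
    have "degree m \<noteq> 0"
    proof
      assume "degree m = 0"
      then obtain c where "m = [:c:]" by (rule degree_eq_zeroE)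
      with m show False by (auto simp: Z_def)
    qed
    have subb: "is_subring (base ` G)"
      unfolding is_subring_def
    proof (intro conjI ballI)
      show "1 \<in> base ` G" using is_subringD(1)[OF sub] by (rule rev_image_eqI) simp
    next
      fix c d assume "c \<in> base ` G" "d \<in> base ` G"
      then obtain c' d' where "c = base c'" "d = base d'" "c' \<in> G" "d' \<in> G" by auto
      then show "c - d \<in> base ` G" "c * d \<in> base ` G"
        using is_subringD(3,4)[OF sub, of c' d'] by (auto intro: rev_image_eqI)
    qed
    have "pderiv m \<in> polys_over (base ` G)"
      using m is_subring_of_nat[OF subb] is_subringD[OF subb]
      by (auto simp: Z_def polys_over_def coeff_pderiv simp del: of_nat_Suc)
    moreover have "pderiv m \<noteq> 0" "degree (pderiv m) < degree m"
      using \<open>degree m \<noteq> 0\<close> by (auto simp: pderiv_eq_0_iff degree_pderiv)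
    ultimately have simple: "poly (pderiv m) b \<noteq> 0"
      using min[of "pderiv m"] by (force simp: Z_def)
    define g where "g = inv_into G base"
    have g: "g c \<in> G" "base (g c) = c" if "c \<in> base ` G" for c
      using that by (simp_all add: g_def inv_into_into f_inv_into_f)
    have "g 0 = 0"
      by (intro sv g is_subringD(2)[OF subb])
    \<comment> \<open>\<open>M\<close> is \<open>m\<close> with each coefficient \<open>c\<close> replaced by \<open>c + D c \<epsilon>\<close>\<close>
    define M where "M = map_poly g m"
    have coeff_M: "coeff M i = g (coeff m i)" for i
      using \<open>g 0 = 0\<close> by (simp add: M_def coeff_map_poly)
    have MG: "coeff M i \<in> G" for i
      using m g by (auto simp: Z_def polys_over_def coeff_M)
    have base_M: "map_poly base M = m"
      using m g by (intro poly_eqI) (auto simp: base_coeff coeff_M Z_def polys_over_def)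
    have deg_M: "degree M = degree m"
    proof (rule antisym)
      show "degree M \<le> degree m" by (simp add: M_def map_poly_degree_leq)
      show "degree m \<le> degree M" using map_poly_degree_leq[of base M] by (simp add: base_M)
    qed
    have lc: "base (lead_coeff M) \<noteq> 0"
      using m by (auto simp: deg_M Z_def simp flip: base_coeff simp: base_M)
    \<comment> \<open>the solution of \<open>M(b + u\<epsilon>) = 0\<close>\<close>
    define u where "u = - tangent (poly M (Dual b 0)) / poly (pderiv m) b"
    define \<beta> where "\<beta> = Dual b u"
    have M0: "poly M \<beta> = 0"
      unfolding \<beta>_def poly_Dual[of M b u]
      using m simple by (intro dual.expand) (auto simp: u_def Z_def base_poly base_M)
    have small: "Q = 0" if "Q \<in> polys_over G" "base (poly Q \<beta>) = 0" "degree Q < degree M" for Q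
    proof (rule ccontr)
      assume "Q \<noteq> 0"
      then have "map_poly base Q \<in> Z"
        using that base_in base_0[of Q] by (auto simp: Z_def base_poly \<beta>_def)
      from min[OF this] show False
        using that(3) map_poly_degree_leq[of base Q] by (simp add: deg_M)
    qed
    have "poly Q \<beta> = 0" if "Q \<in> polys_over G" "base (poly Q \<beta>) = 0" for Q
      using that
    proof (induction "degree Q" arbitrary: Q rule: less_induct)
      case less
      show ?case
      proof (cases "degree Q < degree M")
        case True
        then show ?thesis using small[OF less.prems] by simp
      next
        case False
        \<comment> \<open>one step of pseudo-division of \<open>Q\<close> by \<open>M\<close>\<close>
        define R where "R = smult (lead_coeff M) Q - monom (lead_coeff Q) (degree Q - degree M) * M"
        have QG: "coeff Q i \<in> G" for i using less.prems by (auto simp: polys_over_def)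
        have RG: "R \<in> polys_over G"
          using QG MG is_subringD[OF sub] by (auto simp: R_def polys_over_def coeff_monom_mult)
        have "base (poly R \<beta>) = 0"
          using less.prems(2) M0 by (simp add: R_def)
        have "poly R \<beta> = 0"
        proof (cases "degree R < degree Q")
          case True
          then show ?thesis using less.hyps RG \<open>base (poly R \<beta>) = 0\<close> by blast
        next
          case nless: False
          \<comment> \<open>the leading terms cancel, so this happens only when \<open>R\<close> is zero\<close>
          have "coeff R i = 0" if "i \<ge> degree Q" for i
          proof (cases "i = degree Q")
            case True
            then show ?thesis using False by (simp add: R_def coeff_monom_mult)
          next
            case neq: False
            then have "coeff Q i = 0" "coeff M (i - (degree Q - degree M)) = 0"
              using that False by (auto intro!: coeff_eq_0)
            then show ?thesis by (simp add: R_def coeff_monom_mult)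
          qed
          then have "lead_coeff R = 0" using nless by simp
          then show ?thesis by simp
        qed
        then have "lead_coeff M * poly Q \<beta> = 0" using M0 by (simp add: R_def)
        then have "tangent (lead_coeff M * poly Q \<beta>) = 0" by simp
        then have "tangent (poly Q \<beta>) = 0" using lc less.prems(2) by simp
        then show ?thesis using less.prems(2) by (intro dual.expand) auto
      qed
    qed
    then show ?thesis unfolding \<beta>_def by blast
  qed
qed

text \<open>
  By Zorn's lemma there is a maximal derivation graph above \<open>G\<close>, and by the previous lemma
  its domain is the whole field.
\<close>

lemma derivation_extends:
  fixes G :: "'a::field_char_0 dual set"
  assumes "derivation_graph G"
  obtains D where "derivation D" "\<And>a. a \<in> G \<Longrightarrow> tangent a = D (base a)"
proof -
  define \<A> where "\<A> = {H. derivation_graph H \<and> G \<subseteq> H}"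
  have "\<exists>M\<in>\<A>. \<forall>X\<in>\<A>. M \<subseteq> X \<longrightarrow> X = M"
  proof (rule subset_Zorn_nonempty)
    show "\<A> \<noteq> {}" using assms by (auto simp: \<A>_def)
    fix C assume C: "C \<noteq> {}" "subset.chain \<A> C"
    have mem: "H \<in> C \<Longrightarrow> derivation_graph H \<and> G \<subseteq> H" for H
      using C(2) by (auto simp: subset.chain_def \<A>_def)
    have cl: "a - b \<in> \<Union>C \<and> a * b \<in> \<Union>C" if ab: "a \<in> \<Union>C" "b \<in> \<Union>C" for a b
    proof -
      obtain H1 H2 where "H1 \<in> C" "a \<in> H1" "H2 \<in> C" "b \<in> H2"
        using ab by blast
      moreover from this have "H1 \<subseteq> H2 \<or> H2 \<subseteq> H1"
        using subset_chain_def C(2) by metis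
      ultimately obtain H where "H \<in> C" "a \<in> H" "b \<in> H"
        by blast
      moreover from this have "a - b \<in> H" "a * b \<in> H"
        using mem[of H] is_subringD(3,4)[of H a b] by (auto simp only: derivation_graph_def)
      ultimately show ?thesis by blast
    qed
    obtain H0 where "H0 \<in> C" using C(1) by blast
    have "1 \<in> H0" "G \<subseteq> H0"
      using mem[OF \<open>H0 \<in> C\<close>] is_subringD(1) by (auto simp only: derivation_graph_def)
    then have "1 \<in> \<Union>C" "G \<subseteq> \<Union>C" using \<open>H0 \<in> C\<close> by blast+
    moreover have "a = 0" if "a \<in> \<Union>C" "base a = 0" for a
    proof -
      obtain H where "H \<in> C" "a \<in> H" using \<open>a \<in> \<Union>C\<close> by blast
      then show ?thesis using mem[of H] \<open>base a = 0\<close> by (simp add: derivation_graph_def)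
    qed
    ultimately have "derivation_graph (\<Union>C)"
      using cl by (simp only: derivation_graph_def is_subring_def) simp
    then show "\<Union>C \<in> \<A>" using \<open>G \<subseteq> \<Union>C\<close> by (simp add: \<A>_def)
  qed
  then obtain H where "H \<in> \<A>" and max': "\<forall>X\<in>\<A>. H \<subseteq> X \<longrightarrow> X = H" by blast
  then have H: "derivation_graph H" "G \<subseteq> H" by (simp_all add: \<A>_def)
  have max: "X = H" if "derivation_graph X" "H \<subseteq> X" for X
    using max' that H(2) by (simp add: \<A>_def)
  have sub: "is_subring H" and sv: "\<And>a. a \<in> H \<Longrightarrow> base a = 0 \<Longrightarrow> a = 0"
    using H(1) by (auto simp: derivation_graph_def)
  have "\<exists>u. Dual b u \<in> H" for b
  proof -
    obtain u where u: "\<And>Q. Q \<in> polys_over H \<Longrightarrow> base (poly Q (Dual b u)) = 0 \<Longrightarrow> poly Q (Dual b u) = 0"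
      using derivation_graph_adjoin[OF H(1)] by blast
    define H' where "H' = (\<lambda>Q. poly Q (Dual b u)) ` polys_over H"
    have "derivation_graph H'"
      using is_subring_adjoin[OF sub] u by (auto simp: derivation_graph_def H'_def)
    moreover have "H \<subseteq> H'"
    proof
      fix a assume "a \<in> H"
      then have "[:a:] \<in> polys_over H"
        using is_subringD[OF sub] by (auto simp: polys_over_def coeff_pCons split: nat.splits)
      then show "a \<in> H'" unfolding H'_def by (rule rev_image_eqI) simp
    qed
    ultimately have "H' = H" by (rule max)
    have "[:0, 1:] \<in> polys_over H"
      using is_subringD[OF sub] by (auto simp: polys_over_def coeff_pCons split: nat.splits)
    then have "Dual b u \<in> H'" unfolding H'_def by (rule rev_image_eqI) simp
    then show ?thesis using \<open>H' = H\<close> by blast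
  qed
  then obtain D where D: "\<And>b. Dual b (D b) \<in> H" by metis
  have eq: "tangent a = D (base a)" if "a \<in> H" for a
    using sv[OF is_subringD(3)[OF sub that D[of "base a"]]] by (metis dual.sel(2) dual_simps(7,8)
        dual.sel(1) dual_simps(2) eq_iff_diff_eq_0)
  have "D (a + b) = D a + D b" for a b
    using eq[OF is_subringD(5)[OF sub D[of a] D[of b]]] by simp
  moreover have "D (a * b) = D a * b + a * D b" for a b
    using eq[OF is_subringD(4)[OF sub D[of a] D[of b]]] by simp
  ultimately have "derivation D" by (simp add: derivation_def)
  then show thesis using that eq H(2) by blast
qed


section \<open>Derivations at an algebraically independent point\<close>

lemma poly_mapping_single_induct [case_names zero add]:
  assumes "P 0" "\<And>f m c. P f \<Longrightarrow> P (f + Poly_Mapping.single m c)"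
  shows "P (f :: 'a \<Rightarrow>\<^sub>0 'b::monoid_add)"
proof (induction f rule: update_induct)
  case (update f m c)
  have "Poly_Mapping.update m c f = f + Poly_Mapping.single m c"
    using update(1) by (intro poly_mapping_eqI) (auto simp: lookup_update lookup_add lookup_single in_keys_iff when_def)
  then show ?case using assms(2)[OF update(3)] by simp
qed (rule assms(1))

definition eval_monomial :: "('i \<Rightarrow> real) \<Rightarrow> ('i \<Rightarrow>\<^sub>0 nat) \<Rightarrow> real" where
  "eval_monomial a m = (\<Prod>i\<in>Poly_Mapping.keys m. a i ^ Poly_Mapping.lookup m i)"

lemma eval_monomial_add: "eval_monomial a (m + n) = eval_monomial a m * eval_monomial a n"
proof -
  let ?A = "Poly_Mapping.keys m \<union> Poly_Mapping.keys n"
  have *: "eval_monomial a k = (\<Prod>i\<in>?A. a i ^ Poly_Mapping.lookup k i)" if "Poly_Mapping.keys k \<subseteq> ?A" for k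
    unfolding eval_monomial_def using that by (intro prod.mono_neutral_left) (auto simp: in_keys_iff)
  show ?thesis
    by (subst (1 2 3) *) (use keys_add[of m n] in \<open>auto simp: lookup_add power_add prod.distrib\<close>)
qed

lemma eval_rat_mpoly_add: "eval_rat_mpoly a (f + g) = eval_rat_mpoly a f + eval_rat_mpoly a g"
  unfolding eval_rat_mpoly_def
  by (rule setsum_keys_plus_distrib) (auto simp: of_rat_add algebra_simps)

lemma eval_rat_mpoly_single:
  "eval_rat_mpoly a (Poly_Mapping.single m c) = of_rat c * eval_monomial a m"
  by (auto simp: eval_rat_mpoly_def eval_monomial_def)

lemma eval_rat_mpoly_0: "eval_rat_mpoly a 0 = 0"
  by (simp add: eval_rat_mpoly_def)

lemma eval_rat_mpoly_mult: "eval_rat_mpoly a (f * g) = eval_rat_mpoly a f * eval_rat_mpoly a g"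
proof (induction f rule: poly_mapping_single_induct)
  case (add f m c)
  have "eval_rat_mpoly a (Poly_Mapping.single m c * g) = eval_rat_mpoly a (Poly_Mapping.single m c) * eval_rat_mpoly a g"
    by (induction g rule: poly_mapping_single_induct)
      (simp_all add: eval_rat_mpoly_0 eval_rat_mpoly_add eval_rat_mpoly_single distrib_left
        mult_single eval_monomial_add of_rat_mult)
  then show ?case using add by (simp add: distrib_right eval_rat_mpoly_add)
qed (simp add: eval_rat_mpoly_0)

lemma eval_rat_mpoly_diff: "eval_rat_mpoly a (f - g) = eval_rat_mpoly a f - eval_rat_mpoly a g"
  using eval_rat_mpoly_add[of a "f - g" g] by simp

lemma eval_rat_mpoly_one: "eval_rat_mpoly a 1 = 1"
  using eval_rat_mpoly_single[of a 0 1] by (simp add: eval_monomial_def)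

lemma eval_rat_mpoly_var: "eval_rat_mpoly a (Poly_Mapping.single (Poly_Mapping.single i (Suc 0)) 1) = a i"
  by (simp add: eval_rat_mpoly_single eval_monomial_def)

lemma eval_rat_mpoly_line_differentiable:
  "(\<lambda>t. eval_rat_mpoly (\<lambda>i. a i + t * z i) f) field_differentiable at t0"
proof -
  have "(\<lambda>t. \<Prod>i\<in>I. (a i + t * z i) ^ k i) field_differentiable at t0" for I k
    by (induction I rule: infinite_finite_induct) (auto intro!: derivative_intros field_differentiable_power)
  then show ?thesis
    unfolding eval_rat_mpoly_def by (intro derivative_intros) auto
qed

text \<open>
  Since no nonzero rational polynomial vanishes at \<open>a\<close>, sending \<open>f(a)\<close> to the derivative of \<open>f\<close> at
  \<open>a\<close> in the direction \<open>z\<close> is a well-defined derivation on the ring of all values \<open>f(a)\<close>. It extends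
  to all of the reals. This is the only form in which genericity enters: derivations of the
  reals can move the coordinates of a generic point in any direction, while every number that depends
  algebraically on them is carried along.
\<close>

lemma algebraically_independent_derivation:
  assumes "algebraically_independent_rat a"
  obtains D where "derivation D" "\<And>i. D (a i) = z i"
proof -
  define h where "h f t = eval_rat_mpoly (\<lambda>i. a i + t * z i) f" for f and t :: real
  have h_diff: "h f field_differentiable at t" for f t
    unfolding h_def by (rule eval_rat_mpoly_line_differentiable)
  define \<phi> where "\<phi> f = Dual (h f 0) (deriv (h f) 0)" for f
  have "1 \<in> range \<phi>"
    by (rule range_eqI[of _ _ 1]) (simp add: \<phi>_def h_def[abs_def] eval_rat_mpoly_one one_dual_def)
  moreover have "\<phi> f - \<phi> g = \<phi> (f - g)" "\<phi> f * \<phi> g = \<phi> (f * g)" for f g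
  proof -
    have "h (f - g) = (\<lambda>t. h f t - h g t)" "h (f * g) = (\<lambda>t. h f t * h g t)"
      by (auto simp: h_def eval_rat_mpoly_diff eval_rat_mpoly_mult)
    then show "\<phi> f - \<phi> g = \<phi> (f - g)" "\<phi> f * \<phi> g = \<phi> (f * g)"
      by (auto intro!: dual.expand simp: \<phi>_def h_diff)
  qed
  moreover have "\<phi> f = 0" if "base (\<phi> f) = 0" for f
  proof -
    have "f = 0" using that assms by (simp add: \<phi>_def h_def algebraically_independent_rat_def)
    then show ?thesis by (simp add: \<phi>_def h_def[abs_def] eval_rat_mpoly_0 zero_dual_def)
  qed
  ultimately have "derivation_graph (range \<phi>)"
    unfolding derivation_graph_def is_subring_def by auto
  then obtain D where D: "derivation D" "\<And>c. c \<in> range \<phi> \<Longrightarrow> tangent c = D (base c)"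
    using derivation_extends by blast
  have "D (a i) = z i" for i
  proof -
    have "deriv (\<lambda>t. a i + t * z i) 0 = z i"
      by (rule DERIV_imp_deriv) (auto intro!: derivative_eq_intros)
    then show ?thesis
      using D(2)[OF rangeI, of "Poly_Mapping.single (Poly_Mapping.single i 1) 1"]
      by (simp add: \<phi>_def h_def[abs_def] eval_rat_mpoly_var)
  qed
  then show thesis using that D(1) by blast
qed

lemma derivation_simps:
  fixes D :: "real \<Rightarrow> real"
  assumes "derivation D"
  shows "D (a + b) = D a + D b" "D (a * b) = D a * b + a * D b" "D 0 = 0" "D 1 = 0"
    "D (- a) = - D a" "D (a - b) = D a - D b" "D (sum f I) = (\<Sum>i\<in>I. D (f i))"
    "D (a ^ n) = of_nat n * a ^ (n - 1) * D a"
proof -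
  show add: "D (a + b) = D a + D b" and mult: "D (a * b) = D a * b + a * D b" for a b
    using assms by (auto simp: derivation_def)
  show zero: "D 0 = 0" using add[of 0 0] by simp
  show one: "D 1 = 0" using mult[of 1 1] by simp
  show minus: "D (- a) = - D a" for a using add[of a "- a"] zero by simp
  show "D (a - b) = D a - D b" using add[of a "- b"] minus by simp
  show "D (sum f I) = (\<Sum>i\<in>I. D (f i))"
    by (induction I rule: infinite_finite_induct) (auto simp: zero add)
  show "D (a ^ n) = of_nat n * a ^ (n - 1) * D a"
  proof (induction n)
    case (Suc n)
    then show ?case by (cases n) (auto simp: mult algebra_simps)
  qed (simp add: one)
qed

lemma derivation_linear_combination:
  fixes z :: "'i \<Rightarrow> real"
  assumes "\<And>i. i \<in> I \<Longrightarrow> derivation (\<delta> i)"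
  shows "derivation (\<lambda>r. \<Sum>i\<in>I. z i * \<delta> i r)"
  unfolding derivation_def
proof (intro conjI allI)
  fix a b :: real
  show "(\<Sum>i\<in>I. z i * \<delta> i (a + b)) = (\<Sum>i\<in>I. z i * \<delta> i a) + (\<Sum>i\<in>I. z i * \<delta> i b)"
    using assms by (simp add: derivation_simps(1) sum.distrib distrib_left cong: sum.cong)
  show "(\<Sum>i\<in>I. z i * \<delta> i (a * b)) = (\<Sum>i\<in>I. z i * \<delta> i a) * b + a * (\<Sum>i\<in>I. z i * \<delta> i b)"
    unfolding sum_distrib_left sum_distrib_right sum.distrib[symmetric]
    by (rule sum.cong) (auto simp: assms derivation_simps(2) algebra_simps)
qed

section \<open>Stresses and weighted Laplacians, one coordinate at a time\<close>

text \<open>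
  For the Laplacian \<open>L\<close> with edge weights \<open>\<omega>(ij) (q\<^sub>j - q\<^sub>i)\<^bsup>p-2\<^esup>\<close> this is \<open>2 u\<^sup>T L v\<close>; the factor
  comes from summing over ordered pairs. For even \<open>p\<close> it carries both kinds of information about
  a stress: if \<open>q\<close> is a coordinate of a framework, then \<open>stress_form p E \<omega> q q\<close> vanishes identically exactly
  when \<open>\<omega>\<close> is in equilibrium in that coordinate, and \<open>stress_form p E \<omega> q u\<close> vanishes identically
  exactly when \<open>u\<close> lies in the kernel of the Laplacian of the coordinated stress.
\<close>

definition stress_form ::
  "nat \<Rightarrow> 'v::finite set set \<Rightarrow> ('v set \<Rightarrow> real) \<Rightarrow> ('v \<Rightarrow> real) \<Rightarrow> ('v \<Rightarrow> real) \<Rightarrow> ('v \<Rightarrow> real) \<Rightarrow> real" where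
  "stress_form p E \<omega> q u v =
     (\<Sum>i\<in>UNIV. \<Sum>j\<in>neighbours E i. \<omega> {i, j} * (q j - q i) ^ (p - 2) * (u j - u i) * (v j - v i))"

definition affine_in :: "('v \<Rightarrow> real) \<Rightarrow> ('v \<Rightarrow> real) \<Rightarrow> bool" where
  "affine_in q u \<longleftrightarrow> (\<exists>\<alpha> \<beta>. \<forall>i. u i = \<alpha> * q i + \<beta>)"

lemma neighbours_sym: "j \<in> neighbours E i \<longleftrightarrow> i \<in> neighbours E j"
  by (simp add: neighbours_def insert_commute)

lemma sum_neighbours_swap:
  fixes f :: "'v::finite \<Rightarrow> 'v \<Rightarrow> real"
  shows "(\<Sum>i\<in>UNIV. \<Sum>j\<in>neighbours E i. f i j) = (\<Sum>i\<in>UNIV. \<Sum>j\<in>neighbours E i. f j i)"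
proof -
  have "(\<Sum>i\<in>UNIV. \<Sum>j\<in>neighbours E i. f i j) = (\<Sum>j\<in>UNIV. \<Sum>i | i \<in> UNIV \<and> j \<in> neighbours E i. f i j)"
    using sum.swap_restrict[of UNIV UNIV f "\<lambda>i j. j \<in> neighbours E i"] by simp
  also have "\<dots> = (\<Sum>j\<in>UNIV. \<Sum>i\<in>neighbours E j. f i j)"
    by (intro sum.cong) (auto simp: neighbours_sym)
  finally show ?thesis .
qed

lemma sum_by_parts:
  fixes c :: "'v::finite \<Rightarrow> 'v \<Rightarrow> real"
  assumes "\<And>i j. c j i = - c i j"
  shows "(\<Sum>i\<in>UNIV. \<Sum>j\<in>neighbours E i. c i j * (v j - v i)) =
         - 2 * (\<Sum>i\<in>UNIV. v i * (\<Sum>j\<in>neighbours E i. c i j))"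
proof -
  have "(\<Sum>i\<in>UNIV. \<Sum>j\<in>neighbours E i. c i j * v j) = (\<Sum>i\<in>UNIV. \<Sum>j\<in>neighbours E i. c j i * v i)"
    by (rule sum_neighbours_swap)
  also have "\<dots> = - (\<Sum>i\<in>UNIV. \<Sum>j\<in>neighbours E i. c i j * v i)"
    by (subst assms) (simp add: sum_negf)
  finally show ?thesis
    by (simp add: right_diff_distrib sum_subtractf sum_distrib_left mult_ac)
qed

lemma stress_form_by_parts:
  assumes "even p"
  shows "stress_form p E \<omega> q u v =
    - 2 * (\<Sum>i\<in>UNIV. v i * (\<Sum>j\<in>neighbours E i. \<omega> {i, j} * (q j - q i) ^ (p - 2) * (u j - u i)))"
  unfolding stress_form_def
proof (rule sum_by_parts)
  fix i j
  have "(q i - q j) ^ (p - 2) = (q j - q i) ^ (p - 2)"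
    using assms uminus_power_if[of "q j - q i" "p - 2"] by simp
  then show "\<omega> {j, i} * (q i - q j) ^ (p - 2) * (u i - u j) = - (\<omega> {i, j} * (q j - q i) ^ (p - 2) * (u j - u i))"
    by (simp add: insert_commute algebra_simps)
qed

lemma stress_form_eq_0_iff:
  assumes "even p"
  shows "(\<forall>v. stress_form p E \<omega> q u v = 0) \<longleftrightarrow>
    (\<forall>i. (\<Sum>j\<in>neighbours E i. \<omega> {i, j} * (q j - q i) ^ (p - 2) * (u j - u i)) = 0)"
    (is "?L \<longleftrightarrow> (\<forall>i. ?s i = 0)")
proof
  assume ?L
  show "\<forall>i. ?s i = 0"
  proof
    fix i
    have "stress_form p E \<omega> q u (\<lambda>j. if j = i then 1 else 0) = - 2 * ?s i"
      unfolding stress_form_by_parts[OF assms]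
      by (subst sum.remove[of UNIV i]) auto
    then show "?s i = 0" using \<open>?L\<close> by simp
  qed
next
  assume "\<forall>i. ?s i = 0"
  then show ?L unfolding stress_form_by_parts[OF assms] by simp
qed

lemma power_odd_split: "p > 0 \<Longrightarrow> even p \<Longrightarrow> (a::real) ^ (p - 2) * a = a ^ (p - 1)"
proof -
  assume "p > 0" "even p"
  then have "p - 1 = Suc (p - 2)" by (auto elim!: evenE)
  then show ?thesis by simp
qed

lemma self_stress_iff:
  assumes "even p" "p > 0"
  shows "self_stress p E x \<omega> \<longleftrightarrow>
    (\<forall>k v. stress_form p E \<omega> (\<lambda>i. x i $ k) (\<lambda>i. x i $ k) v = 0)"
proof -
  have "self_stress p E x \<omega> \<longleftrightarrow>
     (\<forall>i k. (\<Sum>j\<in>neighbours E i. \<omega> {i, j} * (x j $ k - x i $ k) ^ (p - 1)) = 0)"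
    by (simp add: self_stress_def vec_eq_iff coord_power_def)
  then show ?thesis
    using assms by (subst stress_form_eq_0_iff) (auto simp: mult.assoc power_odd_split)
qed

lemma stress_form_linear:
  "stress_form p E \<omega> q (\<lambda>i. c * u i + d) v = c * stress_form p E \<omega> q u v"
  "stress_form p E \<omega> q u (\<lambda>i. 0) = 0"
proof -
  have "c * u j + d - (c * u i + d) = c * (u j - u i)" for i j
    by (simp add: algebra_simps)
  then show "stress_form p E \<omega> q (\<lambda>i. c * u i + d) v = c * stress_form p E \<omega> q u v"
    by (simp add: stress_form_def sum_distrib_left mult_ac)
qed (simp add: stress_form_def)

lemma laplacian_mult_nth:
  assumes "simple_graph E"
  shows "(weighted_laplacian E w *v u) $ i = (\<Sum>j\<in>neighbours E i. w {i, j} * (u $ i - u $ j))"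
proof -
  have ni: "i \<notin> neighbours E i"
    using assms by (auto simp: simple_graph_def neighbours_def)
  have "(weighted_laplacian E w *v u) $ i = (\<Sum>j\<in>UNIV. weighted_laplacian E w $ i $ j * u $ j)"
    by (simp add: matrix_vector_mult_def)
  also have "\<dots> = (\<Sum>l\<in>neighbours E i. w {i, l}) * u $ i + (\<Sum>j\<in>UNIV - {i}. (if {i, j} \<in> E then - w {i, j} * u $ j else 0))"
    by (subst sum.remove[of _ i]) (auto simp: weighted_laplacian_def intro!: sum.cong split: if_splits)
  also have "(\<Sum>j\<in>UNIV - {i}. (if {i, j} \<in> E then - w {i, j} * u $ j else 0)) = (\<Sum>j\<in>neighbours E i. - w {i, j} * u $ j)"
    using ni by (intro sum.mono_neutral_cong_right) (auto simp: neighbours_def)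
  finally show ?thesis
    by (simp add: sum_distrib_right right_diff_distrib sum_subtractf sum_negf)
qed

lemma kernel_of_rank_deficit_two:
  fixes A :: "real ^ 'n ^ 'n"
  assumes "rank A = CARD('n) - 2" "CARD('n) \<ge> 2"
    and "A *v a = 0" "A *v b = 0" "independent {a, b}" "a \<noteq> b" "A *v u = 0"
  shows "u \<in> span {a, b}"
proof -
  have orth: "A *v c = 0 \<longleftrightarrow> (\<forall>r\<in>rows A. orthogonal r c)" for c
    by (auto simp: vec_eq_iff rows_def orthogonal_def matrix_vector_mult_def row_def inner_vec_def)
  define K where "K = {c. \<forall>r\<in>span (rows A). orthogonal r c}"
  have K: "c \<in> K \<longleftrightarrow> A *v c = 0" for c
    unfolding K_def orth mem_Collect_eq
    by (meson orthogonal_commute orthogonal_to_span span_base)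
  have "dim K + rank A = CARD('n)"
    using dim_subspace_orthogonal_to_vectors[of "span (rows A)" UNIV]
    by (simp add: K_def row_rank_def)
  then have "dim K = card {a, b}" using assms by simp
  moreover have "{a, b} \<subseteq> K" using assms K by auto
  ultimately have "K \<subseteq> span {a, b}"
    using assms(5) card_eq_dim[of "{a, b}" K] by auto
  then show ?thesis using K assms by auto
qed

text \<open>
  The kernel of a Laplacian always contains the constants. If it also contains a nonconstant \<open>q\<close> and
  the rank is \<open>n - 2\<close>, there is no room for anything but affine images of \<open>q\<close>.
\<close>

lemma laplacian_kernel_affine:
  fixes E :: "'v::finite set set"
  assumes "simple_graph E" "rank (weighted_laplacian E w) = CARD('v) - 2" "CARD('v) \<ge> 2"
    and q: "\<And>i. (\<Sum>j\<in>neighbours E i. w {i, j} * (q j - q i)) = 0" "q a \<noteq> q b"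
    and u: "\<And>i. (\<Sum>j\<in>neighbours E i. w {i, j} * (u j - u i)) = 0"
  shows "affine_in q u"
proof -
  let ?A = "weighted_laplacian E w"
  have ker: "?A *v vec_lambda z = 0" if "\<And>i. (\<Sum>j\<in>neighbours E i. w {i, j} * (z j - z i)) = 0" for z
  proof -
    have "(?A *v vec_lambda z) $ i = - (\<Sum>j\<in>neighbours E i. w {i, j} * (z j - z i))" for i
      by (simp add: laplacian_mult_nth[OF assms(1)] right_diff_distrib sum_subtractf)
    then show ?thesis using that by (simp add: vec_eq_iff)
  qed
  let ?q = "\<chi> i. q i" and ?one = "(\<chi> i. 1) :: real ^ 'v"
  have one_ne: "?one \<noteq> 0" by (simp add: vec_eq_iff)
  have nspan: "?q \<notin> span {?one}"
    using q(2) by (auto simp: span_singleton vec_eq_iff)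
  have "independent {?q, ?one}"
    using nspan one_ne by (simp add: independent_insert)
  moreover have "?q \<noteq> ?one" using q(2) by (metis vec_lambda_beta)
  ultimately have "vec_lambda u \<in> span {?q, ?one}"
    using assms(2,3) ker[of q] ker[of "\<lambda>_. 1"] ker[of u] q u
    by (intro kernel_of_rank_deficit_two[of ?A]) auto
  then obtain \<alpha> \<beta> where "vec_lambda u = \<alpha> *\<^sub>R ?q + \<beta> *\<^sub>R ?one"
    by (auto simp: span_insert span_singleton algebra_simps)
  then have "\<And>i. u i = \<alpha> * q i + \<beta>" by (simp add: vec_eq_iff)
  then show ?thesis by (auto simp: affine_in_def)
qed

section \<open>Differentiating identities between edge lengths\<close>

lemma affine_in_transfer:
  assumes "affine_in q (\<lambda>i. c * u i + d * q i)" "c \<noteq> 0"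
  shows "affine_in q u"
proof -
  obtain \<alpha> \<beta> where "\<And>i. c * u i + d * q i = \<alpha> * q i + \<beta>"
    using assms(1) by (auto simp: affine_in_def)
  then have "u i = (\<alpha> - d) / c * q i + \<beta> / c" for i
    using assms(2) by (simp add: field_simps)
  then show ?thesis unfolding affine_in_def by blast
qed

lemma ex_not_affine_in:
  assumes "CARD('v::finite) \<ge> 3" and "inj q"
  shows "\<exists>u :: 'v \<Rightarrow> real. \<not> affine_in q u"
proof -
  obtain S :: "'v set" where "card S = 3"
    using assms(1) obtain_subset_with_card_n by blast
  then obtain a b c :: 'v where "a \<noteq> b" "b \<noteq> c" "a \<noteq> c"
    by (auto simp: card_3_iff)
  have "\<not> affine_in q (\<lambda>i. if i = c then 1 else 0)"
  proof
    assume "affine_in q (\<lambda>i. if i = c then 1 else 0)"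
    then obtain \<alpha> \<beta> where *: "\<And>i. (if i = c then 1 else 0) = \<alpha> * q i + \<beta>"
      by (auto simp: affine_in_def)
    have "\<alpha> * (q a - q b) = 0"
      using *[of a] *[of b] \<open>a \<noteq> c\<close> \<open>b \<noteq> c\<close> by (simp only: if_False right_diff_distrib)
    then have "\<alpha> = 0" using \<open>a \<noteq> b\<close> \<open>inj q\<close> by (simp add: inj_eq)
    then show False using *[of a] *[of c] \<open>a \<noteq> c\<close> by simp
  qed
  then show ?thesis by blast
qed

text \<open>
  A generic framework seen through its coordinate functions \<open>X l\<close>. Genericity is replaced by
  derivations \<open>\<delta> l i\<close> dual to the coordinates, and the rank condition by its consequence
  \<open>contact_space\<close>: the only vectors in the kernels of all coordinated Laplacians in
  direction \<open>l\<close> are the affine images of \<open>X l\<close>.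
\<close>

locale generic_stressed_framework =
  fixes p :: nat
    and E :: "'v::finite set set"
    and X :: "'d::finite \<Rightarrow> 'v \<Rightarrow> real"
    and \<delta> :: "'d \<Rightarrow> 'v \<Rightarrow> real \<Rightarrow> real"
    and stresses :: "('v set \<Rightarrow> real) set"
  defines "stresses \<equiv> {\<omega>. \<forall>l v. stress_form p E \<omega> (X l) (X l) v = 0}"
  assumes even_p: "even p" and p_pos: "p > 0"
    and three_vertices: "CARD('v) \<ge> 3"
    and \<delta>_derivation: "derivation (\<delta> l i)"
    and \<delta>_coordinate: "\<delta> l i (X m j) = (if l = m \<and> i = j then 1 else 0)"
    and contact_space: "(\<And>\<omega> v. \<omega> \<in> stresses \<Longrightarrow> stress_form p E \<omega> (X l) u v = 0) \<Longrightarrow> affine_in (X l) u"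
begin

text \<open>
  The dual derivations combine to a derivation moving \<open>X\<close> in the direction \<open>z\<close>. Taking this
  combination, rather than any derivation that does so, makes it depend linearly on \<open>z\<close>.
\<close>

definition D :: "('d \<Rightarrow> 'v \<Rightarrow> real) \<Rightarrow> real \<Rightarrow> real" where
  "D z r = (\<Sum>(l, i)\<in>UNIV. z l i * \<delta> l i r)"

lemma derivation_D: "derivation (D z)"
  using derivation_linear_combination[of UNIV "\<lambda>(l, i). \<delta> l i" "\<lambda>(l, i). z l i"] \<delta>_derivation
  unfolding D_def by (simp add: case_prod_unfold)

lemma D_coordinate: "D z (X l i) = z l i"
proof -
  have "D z (X l i) = (\<Sum>(m, j)\<in>UNIV. if (m, j) = (l, i) then z l i else 0)"
    unfolding D_def by (rule sum.cong) (auto simp: \<delta>_coordinate)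
  also have "\<dots> = (\<Sum>x\<in>UNIV. if x = (l, i) then z l i else 0)"
    by (rule sum.cong) (auto split: if_splits)
  finally show ?thesis by simp
qed

lemma D_add: "D (\<lambda>l i. z l i + z' l i) r = D z r + D z' r"
  by (simp add: D_def case_prod_unfold distrib_right sum.distrib)

lemma D_scale: "D (\<lambda>l i. c * z l i) r = c * D z r"
  by (simp add: D_def case_prod_unfold sum_distrib_left mult_ac)

definition at_coord :: "'d \<Rightarrow> ('v \<Rightarrow> real) \<Rightarrow> 'd \<Rightarrow> 'v \<Rightarrow> real" where
  "at_coord l z m i = (if m = l then z i else 0)"

lemma at_coord_simps: "at_coord l z l = z" "m \<noteq> l \<Longrightarrow> at_coord l z m = (\<lambda>i. 0)"
  by (auto simp: at_coord_def)

lemma D_at_coord_linear: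
  "D (at_coord l (\<lambda>i. u i + v i)) r = D (at_coord l u) r + D (at_coord l v) r"
  "D (at_coord l (\<lambda>i. c * u i)) r = c * D (at_coord l u) r"
  "D (at_coord l (\<lambda>i. u i - v i)) r = D (at_coord l u) r - D (at_coord l v) r"
proof -
  show add: "D (at_coord l (\<lambda>i. u i + v i)) r = D (at_coord l u) r + D (at_coord l v) r" for u v
    by (simp flip: D_add, rule arg_cong[of _ _ "\<lambda>z. D z r"]) (auto simp: at_coord_def fun_eq_iff)
  show "D (at_coord l (\<lambda>i. c * u i)) r = c * D (at_coord l u) r"
    by (simp flip: D_scale, rule arg_cong[of _ _ "\<lambda>z. D z r"]) (auto simp: at_coord_def fun_eq_iff)
  show "D (at_coord l (\<lambda>i. u i - v i)) r = D (at_coord l u) r - D (at_coord l v) r"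
    using add[of "\<lambda>i. u i - v i" v] by simp
qed

lemma stresses_iff: "\<omega> \<in> stresses \<longleftrightarrow> (\<forall>l v. stress_form p E \<omega> (X l) (X l) v = 0)"
  by (simp add: stresses_def)

lemma inj_X: "inj (X l)"
proof (rule injI, rule ccontr)
  fix a b assume "X l a = X l b" "a \<noteq> b"
  then show False using \<delta>_coordinate[of l a l a] \<delta>_coordinate[of l a l b] by simp
qed

lemma stress_form_self: "stress_form p E \<omega> q q v =
    (\<Sum>i\<in>UNIV. \<Sum>j\<in>neighbours E i. \<omega> {i, j} * ((q j - q i) ^ (p - 1) * (v j - v i)))"
  unfolding power_odd_split[OF p_pos even_p, symmetric] stress_form_def by (simp only: mult.assoc)

lemma power_p: "(a :: real) ^ p = a ^ (p - 1) * a"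
  by (rule power_minus_mult[OF p_pos, symmetric])

lemma derive_edge_term:
  assumes "derivation d"
  shows "d ((q j - q i) ^ (p - 1) * (w j - w i)) =
    real (p - 1) * ((q j - q i) ^ (p - 2) * (w j - w i) * (d (q j) - d (q i)))
      + (q j - q i) ^ (p - 1) * (d (w j) - d (w i))"
proof -
  have "p - 1 - 1 = p - 2" by simp
  then show ?thesis by (simp add: derivation_simps[OF assms] algebra_simps)
qed

lemma derive_power:
  assumes "derivation d"
  shows "d ((q j - q i) ^ p) = real p * ((q j - q i) ^ (p - 1) * (d (q j) - d (q i)))"
  by (simp add: derivation_simps[OF assms])

text \<open>
  The key computation. The hypothesis equates two elements of the space of edge vectors: a
  tangent vector at \<open>q\<close> and a tangent vector at \<open>X\<close>. Apply a derivation and pair the result with a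
  stress. The terms that contain derivatives of \<open>w\<close> and \<open>u\<close> are again tangent vectors
  at \<open>q\<close> and \<open>X\<close>, so the stress annihilates them however complicated these derivatives are. What remains are the terms
  in which the derivation hits the powers, and these are Laplacian forms.
\<close>

lemma differentiated_edge_identity:
  assumes edges: "\<And>i j. {i, j} \<in> E \<Longrightarrow>
      (q j - q i) ^ (p - 1) * (w j - w i) = (\<Sum>l\<in>UNIV. (X l j - X l i) ^ (p - 1) * (u l j - u l i))"
    and \<omega>: "\<omega> \<in> stresses" "\<And>v. stress_form p E \<omega> q q v = 0"
    and d: "derivation d"
  shows "stress_form p E \<omega> q w (\<lambda>i. d (q i)) = (\<Sum>l\<in>UNIV. stress_form p E \<omega> (X l) (u l) (\<lambda>i. d (X l i)))"
proof -
  define T where "T q w i j = \<omega> {i, j} * d ((q j - q i) ^ (p - 1) * (w j - w i))" for q w :: "'v \<Rightarrow> real" and i j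
  have T: "(\<Sum>i\<in>UNIV. \<Sum>j\<in>neighbours E i. T q w i j) =
      real (p - 1) * stress_form p E \<omega> q w (\<lambda>i. d (q i))"
    if "\<And>v. stress_form p E \<omega> q q v = 0" for q w
  proof -
    have "(\<Sum>i\<in>UNIV. \<Sum>j\<in>neighbours E i. T q w i j) =
      real (p - 1) * stress_form p E \<omega> q w (\<lambda>i. d (q i)) + stress_form p E \<omega> q q (\<lambda>i. d (w i))"
      unfolding stress_form_self unfolding stress_form_def T_def derive_edge_term[OF d]
      by (simp add: distrib_left sum.distrib sum_distrib_left mult_ac)
    then show ?thesis using that by simp
  qed
  have "(\<Sum>i\<in>UNIV. \<Sum>j\<in>neighbours E i. T q w i j) =
      (\<Sum>i\<in>UNIV. \<Sum>j\<in>neighbours E i. \<Sum>l\<in>UNIV. T (X l) (u l) i j)"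
  proof (intro sum.cong refl)
    fix i j assume "j \<in> neighbours E i"
    then have "d ((q j - q i) ^ (p - 1) * (w j - w i)) =
        d (\<Sum>l\<in>UNIV. (X l j - X l i) ^ (p - 1) * (u l j - u l i))"
      by (intro arg_cong[of _ _ d] edges) (simp add: neighbours_def)
    then show "T q w i j = (\<Sum>l\<in>UNIV. T (X l) (u l) i j)"
      unfolding T_def by (simp only: derivation_simps(7)[OF d] sum_distrib_left)
  qed
  also have "\<dots> = (\<Sum>l\<in>UNIV. \<Sum>i\<in>UNIV. \<Sum>j\<in>neighbours E i. T (X l) (u l) i j)"
    by (subst sum.swap[of _ UNIV UNIV], intro sum.cong refl) (rule sum.swap)
  finally have "real (p - 1) * stress_form p E \<omega> q w (\<lambda>i. d (q i)) =
      real (p - 1) * (\<Sum>l\<in>UNIV. stress_form p E \<omega> (X l) (u l) (\<lambda>i. d (X l i)))"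
    using \<omega> by (simp add: T stresses_iff sum_distrib_left)
  moreover have "p - 1 \<noteq> 0" using p_pos even_p by (auto elim!: evenE)
  ultimately show ?thesis by simp
qed

text \<open>
  If the left-hand side of such an identity contributes nothing to the previous lemma, moving a single
  coordinate \<open>X l\<close> in an arbitrary direction shows that \<open>u l\<close> lies in the kernel of all coordinated
  Laplacians.
\<close>

lemma contact_vectors_affine:
  assumes edges: "\<And>i j. {i, j} \<in> E \<Longrightarrow>
      (q j - q i) ^ (p - 1) * (w j - w i) = (\<Sum>l\<in>UNIV. (X l j - X l i) ^ (p - 1) * (u l j - u l i))"
    and q: "\<And>\<omega> v. \<omega> \<in> stresses \<Longrightarrow> stress_form p E \<omega> q q v = 0"
    and w: "\<And>\<omega> v. \<omega> \<in> stresses \<Longrightarrow> stress_form p E \<omega> q w v = 0"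
  shows "affine_in (X l) (u l)"
proof (rule contact_space)
  fix \<omega> v assume \<omega>: "\<omega> \<in> stresses"
  have "0 = (\<Sum>m\<in>UNIV. stress_form p E \<omega> (X m) (u m) (\<lambda>i. D (at_coord l v) (X m i)))"
    using differentiated_edge_identity[OF edges \<omega> q[OF \<omega>] derivation_D] w[OF \<omega>] by simp
  also have "\<dots> = (\<Sum>m\<in>UNIV. if m = l then stress_form p E \<omega> (X l) (u l) v else 0)"
    by (intro sum.cong) (auto simp: D_coordinate at_coord_def stress_form_linear(2))
  finally show "stress_form p E \<omega> (X l) (u l) v = 0" by simp
qed

text \<open>
  Differentiating a linear relation between the vectors \<open>(X l j - X l i) ^ p\<close>, with \<open>X l\<close> moving
  in the direction \<open>z\<close>, gives a tangent vector equal to \<open>0\<close> whose component at \<open>l\<close> is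
  \<open>p c\<^sub>l z + (d c\<^sub>l) X l\<close>. This component has to be affine in \<open>X l\<close>. On three or more
  vertices there are vectors \<open>z\<close> that are not affine in \<open>X l\<close>, which forces \<open>c\<^sub>l = 0\<close>.
\<close>

lemma coordinate_lengths_independent:
  assumes "\<And>i j. {i, j} \<in> E \<Longrightarrow> (\<Sum>l\<in>UNIV. c l * (X l j - X l i) ^ p) = 0"
  shows "c l = 0"
proof (rule ccontr)
  assume "c l \<noteq> 0"
  obtain z where z: "\<not> affine_in (X l) z"
    using ex_not_affine_in[OF three_vertices inj_X] by blast
  define d where "d = D (at_coord l z)"
  have d: "derivation d" unfolding d_def by (rule derivation_D)
  define u where "u m i = real p * c m * d (X m i) + d (c m) * X m i" for m i
  have "affine_in (X l) (u l)"
  proof (rule contact_vectors_affine[where q = "\<lambda>_. 0" and w = "\<lambda>_. 0" and u = u])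
    fix i j assume e: "{i, j} \<in> E"
    have "0 = d (\<Sum>m\<in>UNIV. c m * (X m j - X m i) ^ p)"
      using assms[OF e] derivation_simps(3)[OF d] by simp
    also have "\<dots> = (\<Sum>m\<in>UNIV. (X m j - X m i) ^ (p - 1) * (u m j - u m i))"
      unfolding derivation_simps(7)[OF d]
    proof (rule sum.cong[OF refl])
      fix m
      show "d (c m * (X m j - X m i) ^ p) = (X m j - X m i) ^ (p - 1) * (u m j - u m i)"
        unfolding derivation_simps(2)[OF d] derive_power[OF d] u_def
        by (subst power_p) (simp add: algebra_simps)
    qed
    finally show "(0 - 0) ^ (p - 1) * (0 - 0) = (\<Sum>m\<in>UNIV. (X m j - X m i) ^ (p - 1) * (u m j - u m i))"
      by simp
  qed (simp_all add: stress_form_def)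
  moreover have "u l = (\<lambda>i. (real p * c l) * z i + d (c l) * X l i)"
    by (simp add: u_def d_def D_coordinate at_coord_simps fun_eq_iff)
  ultimately have "affine_in (X l) z"
    using affine_in_transfer[of "X l" "real p * c l" z "d (c l)"] \<open>c l \<noteq> 0\<close> p_pos by simp
  with z show False by simp
qed

text \<open>
  An infinitesimal motion \<open>u\<close> is affine in each coordinate, so its scaling factors are the
  coefficients of a linear relation between the coordinate lengths. Hence only translations remain.
\<close>

lemma infinitesimally_rigid:
  assumes "\<And>i j. {i, j} \<in> E \<Longrightarrow> (\<Sum>l\<in>UNIV. (X l j - X l i) ^ (p - 1) * (u l j - u l i)) = 0"
  shows "u l i = u l j"
proof -
  have "affine_in (X l) (u l)" for l
    by (rule contact_vectors_affine[where q = "\<lambda>_. 0" and w = "\<lambda>_. 0" and u = u])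
      (simp_all add: assms[unfolded One_nat_def] stress_form_def)
  then obtain \<alpha> \<beta> where u: "\<And>l i. u l i = \<alpha> l * X l i + \<beta> l"
    unfolding affine_in_def by metis
  have "\<alpha> l = 0" for l
  proof (rule coordinate_lengths_independent)
    fix i j assume "{i, j} \<in> E"
    have "(\<Sum>l\<in>UNIV. \<alpha> l * (X l j - X l i) ^ p) = (\<Sum>l\<in>UNIV. (X l j - X l i) ^ (p - 1) * (u l j - u l i))"
      by (intro sum.cong refl, subst power_p) (simp add: u algebra_simps)
    then show "(\<Sum>l\<in>UNIV. \<alpha> l * (X l j - X l i) ^ p) = 0" using assms[OF \<open>{i, j} \<in> E\<close>] by simp
  qed
  then show ?thesis by (simp add: u)
qed

end

section \<open>Frameworks equivalent to a generic one\<close>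

locale equivalent_framework = generic_stressed_framework p E X \<delta> stresses
  for p :: nat and E :: "'v::finite set set" and X :: "'d::finite \<Rightarrow> 'v \<Rightarrow> real"
    and \<delta> :: "'d \<Rightarrow> 'v \<Rightarrow> real \<Rightarrow> real" and stresses +
  fixes Y :: "'d \<Rightarrow> 'v \<Rightarrow> real"
  assumes equal_lengths: "{i, j} \<in> E \<Longrightarrow> (\<Sum>k\<in>UNIV. (Y k j - Y k i) ^ p) = (\<Sum>l\<in>UNIV. (X l j - X l i) ^ p)"
begin

lemma derivative_of_lengths:
  assumes "{i, j} \<in> E"
  shows "(\<Sum>k\<in>UNIV. (Y k j - Y k i) ^ (p - 1) * (D z (Y k j) - D z (Y k i))) =
    (\<Sum>l\<in>UNIV. (X l j - X l i) ^ (p - 1) * (z l j - z l i))"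
proof -
  have "D z (\<Sum>k\<in>UNIV. (Y k j - Y k i) ^ p) = D z (\<Sum>l\<in>UNIV. (X l j - X l i) ^ p)"
    using equal_lengths[OF assms] by simp
  then have "real p * (\<Sum>k\<in>UNIV. (Y k j - Y k i) ^ (p - 1) * (D z (Y k j) - D z (Y k i))) =
    real p * (\<Sum>l\<in>UNIV. (X l j - X l i) ^ (p - 1) * (z l j - z l i))"
    unfolding derivation_simps(7)[OF derivation_D] derive_power[OF derivation_D] sum_distrib_left
    by (simp only: D_coordinate)
  then show ?thesis using p_pos by simp
qed

text \<open>
  Differentiating the equality of lengths expresses every tangent vector at \<open>X\<close> as a tangent vector at
  \<open>Y\<close>. For the converse, which is what is claimed here, count dimensions: moving \<open>X\<close> along \<open>z\<close> moves
  \<open>Y\<close> along \<open>D z Y\<close>, and modulo translations this linear map is injective because \<open>X\<close> is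
  infinitesimally rigid. Hence it is surjective.
\<close>

lemma tangent_space_contained:
  obtains u where "\<And>i j. {i, j} \<in> E \<Longrightarrow>
    (\<Sum>k\<in>UNIV. (Y k j - Y k i) ^ (p - 1) * (w k j - w k i)) =
    (\<Sum>l\<in>UNIV. (X l j - X l i) ^ (p - 1) * (u l j - u l i))"
proof -
  fix a :: 'v
  define vec where "vec z = (\<chi> k i. z k i)" for z :: "'d \<Rightarrow> 'v \<Rightarrow> real"
  \<comment> \<open>translated so that vertex \<open>a\<close> moves as in \<open>z\<close>, which makes the map itself injective\<close>
  define B :: "real ^ 'v ^ 'd \<Rightarrow> real ^ 'v ^ 'd" where
    "B z = (\<chi> k i. D (\<lambda>l i. z $ l $ i) (Y k i) - D (\<lambda>l i. z $ l $ i) (Y k a) + z $ k $ a)" for z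
  have "linear B"
    by (rule linearI) (simp_all add: B_def vec_eq_iff D_add D_scale algebra_simps)
  moreover have "inj B"
  proof (subst linear_injective_0[OF \<open>linear B\<close>], intro allI impI)
    fix z assume "B z = 0"
    then have B: "D (\<lambda>l i. z $ l $ i) (Y k i) - D (\<lambda>l i. z $ l $ i) (Y k a) + z $ k $ a = 0" for k i
      by (simp add: B_def vec_eq_iff)
    then have za: "z $ k $ a = 0" for k using B[of k a] by simp
    then have Dz: "D (\<lambda>l i. z $ l $ i) (Y k i) = D (\<lambda>l i. z $ l $ i) (Y k a)" for k i
      using B[of k i] by simp
    have "z $ l $ i = z $ l $ a" for l i
    proof (rule infinitesimally_rigid[of "\<lambda>l i. z $ l $ i"])
      fix i j assume "{i, j} \<in> E"
      from derivative_of_lengths[OF this, of "\<lambda>l i. z $ l $ i"]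
      show "(\<Sum>l\<in>UNIV. (X l j - X l i) ^ (p - 1) * (z $ l $ j - z $ l $ i)) = 0"
        by (simp add: Dz[of _ i] Dz[of _ j])
    qed
    then show "z = 0" by (simp add: vec_eq_iff za)
  qed
  ultimately have "surj B" by (rule linear_inj_imp_surj)
  then obtain z where "vec w = B z" by (metis surjD)
  then have w: "w k i = D (\<lambda>l i. z $ l $ i) (Y k i) - D (\<lambda>l i. z $ l $ i) (Y k a) + z $ k $ a" for k i
    by (simp add: vec_def B_def vec_eq_iff)
  show thesis
  proof (rule that)
    fix i j assume "{i, j} \<in> E"
    from derivative_of_lengths[OF this, of "\<lambda>l i. z $ l $ i"]
    show "(\<Sum>k\<in>UNIV. (Y k j - Y k i) ^ (p - 1) * (w k j - w k i)) =
      (\<Sum>l\<in>UNIV. (X l j - X l i) ^ (p - 1) * (z $ l $ j - z $ l $ i))"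
      by (simp add: w)
  qed
qed

lemma coordinate_tangent_contained:
  obtains u where "\<And>i j. {i, j} \<in> E \<Longrightarrow>
    (Y k j - Y k i) ^ (p - 1) * (v j - v i) =
    (\<Sum>l\<in>UNIV. (X l j - X l i) ^ (p - 1) * (u l j - u l i))"
proof -
  obtain u where u: "\<And>i j. {i, j} \<in> E \<Longrightarrow>
    (\<Sum>m\<in>UNIV. (Y m j - Y m i) ^ (p - 1) * (at_coord k v m j - at_coord k v m i)) =
    (\<Sum>l\<in>UNIV. (X l j - X l i) ^ (p - 1) * (u l j - u l i))"
    using tangent_space_contained[of "at_coord k v"] by blast
  have "(\<Sum>m\<in>UNIV. (Y m j - Y m i) ^ (p - 1) * (at_coord k v m j - at_coord k v m i)) =
      (Y k j - Y k i) ^ (p - 1) * (v j - v i)" for i j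
    by (subst sum.remove[of _ k]) (auto simp: at_coord_def)
  with u have "(Y k j - Y k i) ^ (p - 1) * (v j - v i) =
      (\<Sum>l\<in>UNIV. (X l j - X l i) ^ (p - 1) * (u l j - u l i))" if "{i, j} \<in> E" for i j
    using that by (simp only:)
  then show thesis by (rule that)
qed

text \<open>
  Stresses of \<open>X\<close> are the functionals vanishing on the tangent vectors at \<open>X\<close>, hence they also vanish
  on those at \<open>Y\<close>.
\<close>

lemma stress_transfers:
  assumes \<omega>: "\<omega> \<in> stresses"
  shows "stress_form p E \<omega> (Y k) (Y k) v = 0"
proof -
  obtain u where u: "\<And>i j. {i, j} \<in> E \<Longrightarrow>
    (Y k j - Y k i) ^ (p - 1) * (v j - v i) =
    (\<Sum>l\<in>UNIV. (X l j - X l i) ^ (p - 1) * (u l j - u l i))"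
    using coordinate_tangent_contained by blast
  have "stress_form p E \<omega> (Y k) (Y k) v =
      (\<Sum>i\<in>UNIV. \<Sum>j\<in>neighbours E i. \<Sum>l\<in>UNIV. \<omega> {i, j} * ((X l j - X l i) ^ (p - 1) * (u l j - u l i)))"
    unfolding stress_form_self sum_distrib_left[symmetric]
    by (intro sum.cong refl arg_cong[of _ _ "(*) _"] u) (simp add: neighbours_def)
  also have "\<dots> = (\<Sum>l\<in>UNIV. stress_form p E \<omega> (X l) (X l) (u l))"
    unfolding stress_form_self
    by (subst sum.swap[of _ UNIV UNIV], intro sum.cong refl) (rule sum.swap)
  finally show ?thesis using \<omega> by (simp add: stresses_iff)
qed

text \<open>
  The vector \<open>(Y k j - Y k i) ^ p\<close> is the tangent vector at \<open>Y k\<close> in the radial direction \<open>Y k\<close>, and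
  radial directions contribute nothing to the stress form. Written as a tangent vector at \<open>X\<close> it
  is therefore a sum of multiples of radial ones.
\<close>

lemma coordinate_lengths_combination:
  obtains b where "\<And>k i j. {i, j} \<in> E \<Longrightarrow> (Y k j - Y k i) ^ p = (\<Sum>l\<in>UNIV. b k l * (X l j - X l i) ^ p)"
proof -
  have "\<exists>c. \<forall>i j. {i, j} \<in> E \<longrightarrow> (Y k j - Y k i) ^ p = (\<Sum>l\<in>UNIV. c l * (X l j - X l i) ^ p)" for k
  proof -
    obtain u where u: "\<And>i j. {i, j} \<in> E \<Longrightarrow>
        (Y k j - Y k i) ^ (p - 1) * (Y k j - Y k i) =
        (\<Sum>l\<in>UNIV. (X l j - X l i) ^ (p - 1) * (u l j - u l i))"
      using coordinate_tangent_contained by blast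
    have "affine_in (X l) (u l)" for l
      using u stress_transfers by (rule contact_vectors_affine) (simp_all add: stress_transfers)
    then obtain \<alpha> \<beta> where \<alpha>: "\<And>l i. u l i = \<alpha> l * X l i + \<beta> l"
      unfolding affine_in_def by metis
    have "(Y k j - Y k i) ^ p = (\<Sum>l\<in>UNIV. \<alpha> l * (X l j - X l i) ^ p)" if "{i, j} \<in> E" for i j
    proof -
      have "(Y k j - Y k i) ^ p = (\<Sum>l\<in>UNIV. (X l j - X l i) ^ (p - 1) * (u l j - u l i))"
        using u[OF that] by (subst power_p)
      also have "\<dots> = (\<Sum>l\<in>UNIV. \<alpha> l * (X l j - X l i) ^ p)"
        by (intro sum.cong refl, subst power_p) (simp add: \<alpha> algebra_simps)
      finally show ?thesis .
    qed
    then show ?thesis by blast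
  qed
  then have "\<forall>k. \<exists>c. \<forall>i j. {i, j} \<in> E \<longrightarrow> (Y k j - Y k i) ^ p = (\<Sum>l\<in>UNIV. c l * (X l j - X l i) ^ p)"
    by (rule allI)
  from choice[OF this] obtain b where
    b: "\<forall>k i j. {i, j} \<in> E \<longrightarrow> (Y k j - Y k i) ^ p = (\<Sum>l\<in>UNIV. b k l * (X l j - X l i) ^ p)"
    by (rule exE)
  show thesis by (rule that[of b]) (rule b[rule_format])
qed

text \<open>
  Consider one such linear combination. It remains to show that it has a single term: as all the
  \<open>X l\<close> can be moved independently, \<open>Y k\<close> does not have enough freedom to follow two of them.
\<close>

context
  fixes k :: 'd and b :: "'d \<Rightarrow> real"
  assumes combination: "\<And>i j. {i, j} \<in> E \<Longrightarrow> (Y k j - Y k i) ^ p = (\<Sum>l\<in>UNIV. b l * (X l j - X l i) ^ p)"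
begin

text \<open>
  A derivation that moves \<open>Y k\<close> trivially, that is, only by scaling and translation, also moves
  trivially each \<open>X l\<close> that occurs in the combination.
\<close>

lemma affine_derivative:
  assumes "affine_in (Y k) (\<lambda>i. D z (Y k i))" "b l \<noteq> 0"
  shows "affine_in (X l) (z l)"
proof -
  define u where "u m i = real p * b m * z m i + D z (b m) * X m i" for m i
  obtain \<alpha> \<beta> where \<alpha>: "\<And>i. D z (Y k i) = \<alpha> * Y k i + \<beta>"
    using assms(1) by (auto simp: affine_in_def)
  have "affine_in (X l) (u l)"
  proof (rule contact_vectors_affine[where q = "Y k" and w = "\<lambda>i. real p * \<alpha> * Y k i + real p * \<beta>" and u = u])
    fix i j assume e: "{i, j} \<in> E"
    have "real p * ((Y k j - Y k i) ^ (p - 1) * (D z (Y k j) - D z (Y k i))) = D z ((Y k j - Y k i) ^ p)"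
      by (simp only: derive_power[OF derivation_D])
    also have "\<dots> = D z (\<Sum>m\<in>UNIV. b m * (X m j - X m i) ^ p)"
      by (simp only: combination[OF e])
    also have "\<dots> = (\<Sum>m\<in>UNIV. (X m j - X m i) ^ (p - 1) * (u m j - u m i))"
      unfolding derivation_simps(7)[OF derivation_D]
    proof (rule sum.cong[OF refl])
      fix m
      show "D z (b m * (X m j - X m i) ^ p) = (X m j - X m i) ^ (p - 1) * (u m j - u m i)"
        unfolding derivation_simps(2)[OF derivation_D] derive_power[OF derivation_D] u_def D_coordinate
        by (subst power_p) (simp add: algebra_simps)
    qed
    finally show "(Y k j - Y k i) ^ (p - 1) *
        (real p * \<alpha> * Y k j + real p * \<beta> - (real p * \<alpha> * Y k i + real p * \<beta>)) =
        (\<Sum>m\<in>UNIV. (X m j - X m i) ^ (p - 1) * (u m j - u m i))"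
      by (simp add: \<alpha> algebra_simps)
  qed (simp_all add: stress_transfers stress_form_linear(1))
  moreover have "u l = (\<lambda>i. (real p * b l) * z l i + D z (b l) * X l i)"
    by (simp add: u_def fun_eq_iff)
  ultimately show ?thesis
    using affine_in_transfer[of "X l" "real p * b l" "z l" "D z (b l)"] assms(2) p_pos by simp
qed

text \<open>
  Motions of \<open>X l\<close> alone already induce all motions of \<open>Y k\<close> modulo trivial ones: the induced map
  between the spaces of motions modulo scaling and translation, which have equal dimension, is
  injective by the previous lemma. So a nontrivial motion \<open>\<zeta>\<close> of \<open>X m\<close> can be compensated by a motion of
  \<open>X l\<close> so that together they move \<open>Y k\<close> trivially, which contradicts the previous lemma at \<open>m\<close>.
\<close>

lemma at_most_one_coefficient:
  assumes "b l \<noteq> 0" "b m \<noteq> 0"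
  shows "l = m"
proof (rule ccontr)
  assume "l \<noteq> m"
  have "\<exists>a c. Y k a \<noteq> Y k c"
  proof (rule ccontr)
    assume "\<not> ?thesis"
    then have "Y k j - Y k i = 0" for i j by (simp only: not_ex not_not right_minus_eq)
    then have zero: "(Y k j - Y k i) ^ p = 0" for i j by (simp only: zero_power[OF p_pos])
    have "b l = 0"
      by (rule coordinate_lengths_independent[of b]) (simp only: combination[symmetric] zero)
    with assms show False by simp
  qed
  then obtain a c where ac: "Y k a \<noteq> Y k c" by blast
  define F where "F n z i = D (at_coord n z) (Y k i)" for n z i
  have F_add: "F n (\<lambda>i. u i + v i) i = F n u i + F n v i"
    and F_scale: "F n (\<lambda>i. r * u i) i = r * F n u i" for n u v r i
    by (simp_all add: F_def D_at_coord_linear)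
  \<comment> \<open>Trivial motions are normalised away at the vertices \<open>a\<close> and \<open>c\<close>: the motion of \<open>Y k\<close>
      is corrected by a multiple of \<open>Y k\<close> and a translation so as to agree there with \<open>z\<close>.\<close>
  define s where "s z = (z c - z a - (F l z c - F l z a)) / (Y k c - Y k a)" for z
  have s_add: "s (\<lambda>i. u i + v i) = s u + s v" and s_scale: "s (\<lambda>i. r * u i) = r * s u" for u v r
    by (simp_all add: s_def F_add F_scale add_divide_distrib[symmetric] algebra_simps)
  define B :: "real ^ 'v \<Rightarrow> real ^ 'v" where
    "B z = (\<chi> i. F l (($) z) i - F l (($) z) a + z $ a + s (($) z) * (Y k i - Y k a))" for z
  have fun_add: "($) (u + v) = (\<lambda>i. u $ i + v $ i)" and fun_scale: "($) (r *\<^sub>R u) = (\<lambda>i. r * u $ i)"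
    for u v :: "real ^ 'v" and r
    by auto
  have "linear B"
    by (rule linearI) (simp_all add: B_def vec_eq_iff fun_add fun_scale F_add F_scale s_add s_scale algebra_simps)
  moreover have "inj B"
  proof (subst linear_injective_0[OF \<open>linear B\<close>], intro allI impI)
    fix z assume "B z = 0"
    then have B: "F l (($) z) i - F l (($) z) a + z $ a + s (($) z) * (Y k i - Y k a) = 0" for i
      by (simp add: B_def vec_eq_iff)
    have za: "z $ a = 0" using B[of a] by simp
    have zc: "z $ c = 0" using B[of c] ac by (simp add: s_def)
    have "affine_in (Y k) (\<lambda>i. D (at_coord l (($) z)) (Y k i))"
      unfolding affine_in_def
      using B za
      by (intro exI[of _ "- s (($) z)"] exI[of _ "F l (($) z) a + s (($) z) * Y k a"])
        (auto simp: F_def algebra_simps)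
    then have "affine_in (X l) (at_coord l (($) z) l)"
      by (rule affine_derivative) (rule assms(1))
    then obtain \<alpha> \<beta> where \<alpha>: "\<And>i. z $ i = \<alpha> * X l i + \<beta>"
      by (auto simp: affine_in_def at_coord_simps)
    have "\<alpha> * (X l a - X l c) = 0" using \<alpha>[of a] \<alpha>[of c] za zc by (simp only: right_diff_distrib)
    moreover have "X l a \<noteq> X l c" using ac inj_X[of l] by (auto simp: inj_eq)
    ultimately have "\<alpha> = 0" by simp
    then show "z = 0" using \<alpha> za by (simp add: vec_eq_iff)
  qed
  ultimately have "surj B" by (rule linear_inj_imp_surj)
  obtain \<zeta> where \<zeta>: "\<not> affine_in (X m) \<zeta>"
    using ex_not_affine_in[OF three_vertices inj_X] by blast
  obtain z where "(\<chi> i. F m \<zeta> i) = B z" using \<open>surj B\<close> by (metis surjD)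
  then have Bz: "F m \<zeta> i = F l (($) z) i - F l (($) z) a + z $ a + s (($) z) * (Y k i - Y k a)" for i
    by (simp add: B_def vec_eq_iff)
  \<comment> \<open>\<open>X m\<close> moves along \<open>\<zeta>\<close> while \<open>X l\<close> moves back along \<open>z\<close>\<close>
  define \<xi> where "\<xi> n i = at_coord m \<zeta> n i + (- 1) * at_coord l (($) z) n i" for n i
  have "D \<xi> (Y k i) = F m \<zeta> i - F l (($) z) i" for i
  proof -
    have "D \<xi> (Y k i) = D (at_coord m \<zeta>) (Y k i) + D (\<lambda>n i. (- 1) * at_coord l (($) z) n i) (Y k i)"
      unfolding \<xi>_def by (rule D_add)
    then show ?thesis by (simp only: D_scale F_def)
  qed
  then have "affine_in (Y k) (\<lambda>i. D \<xi> (Y k i))"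
    unfolding affine_in_def
    by (intro exI[of _ "s (($) z)"] exI[of _ "- F l (($) z) a + z $ a - s (($) z) * Y k a"])
      (simp add: Bz algebra_simps)
  then have "affine_in (X m) (\<xi> m)"
    by (rule affine_derivative) (rule assms(2))
  moreover have "\<xi> m = \<zeta>" using \<open>l \<noteq> m\<close> by (auto simp: \<xi>_def at_coord_def)
  ultimately show False using \<zeta> by simp
qed

end

text \<open>
  Summing the combinations over \<open>k\<close> and using that the coordinate lengths of \<open>X\<close> are linearly
  independent, the coefficients in front of each \<open>X l\<close> add up to \<open>1\<close>. Thus every \<open>l\<close> occurs for some \<open>k\<close>,
  and as every \<open>k\<close> has at most one \<open>l\<close>, this is a bijection with all coefficients equal to \<open>1\<close>.
\<close>

lemma coordinate_matching:
  obtains \<sigma> where "bij \<sigma>"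
    "\<And>l i j. {i, j} \<in> E \<Longrightarrow> (Y (\<sigma> l) j - Y (\<sigma> l) i) ^ p = (X l j - X l i) ^ p"
proof -
  obtain b where b: "\<And>k i j. {i, j} \<in> E \<Longrightarrow> (Y k j - Y k i) ^ p = (\<Sum>l\<in>UNIV. b k l * (X l j - X l i) ^ p)"
    using coordinate_lengths_combination by blast
  have unique: "l = m" if "b k l \<noteq> 0" "b k m \<noteq> 0" for k l m
    by (rule at_most_one_coefficient[of k "b k"]) (fact b that)+
  have "(\<Sum>k\<in>UNIV. b k l) - 1 = 0" for l
  proof (rule coordinate_lengths_independent[of "\<lambda>l. (\<Sum>k\<in>UNIV. b k l) - 1"])
    fix i j assume e: "{i, j} \<in> E"
    have "(\<Sum>l\<in>UNIV. (X l j - X l i) ^ p) = (\<Sum>k\<in>UNIV. \<Sum>l\<in>UNIV. b k l * (X l j - X l i) ^ p)"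
      using equal_lengths[OF e] b[OF e] by simp
    also have "\<dots> = (\<Sum>l\<in>UNIV. (\<Sum>k\<in>UNIV. b k l) * (X l j - X l i) ^ p)"
      by (subst sum.swap) (simp add: sum_distrib_right)
    finally show "(\<Sum>l\<in>UNIV. ((\<Sum>k\<in>UNIV. b k l) - 1) * (X l j - X l i) ^ p) = 0"
      by (simp add: left_diff_distrib sum_subtractf)
  qed
  then have sum1: "(\<Sum>k\<in>UNIV. b k l) = 1" for l by simp
  have "\<exists>k. b k l \<noteq> 0" for l
  proof (rule ccontr)
    assume "\<not> ?thesis"
    then show False using sum1[of l] by simp
  qed
  then obtain \<sigma> where \<sigma>: "\<And>l. b (\<sigma> l) l \<noteq> 0" by metis
  have "inj \<sigma>"
  proof (rule injI)
    fix l m assume "\<sigma> l = \<sigma> m"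
    then show "l = m" using unique[of "\<sigma> m" l m] \<sigma>[of l] \<sigma>[of m] by simp
  qed
  then have "bij \<sigma>" by (simp add: bij_def finite_UNIV_inj_surj)
  have off: "b (\<sigma> l) m = 0" if "m \<noteq> l" for l m
    using unique[of "\<sigma> l" m l] \<sigma>[of l] that by auto
  have diag: "b (\<sigma> l) l = 1" for l
  proof -
    have "b k l = 0" if "k \<noteq> \<sigma> l" for k
    proof -
      obtain m where "k = \<sigma> m" using \<open>bij \<sigma>\<close> by (meson bij_pointE)
      moreover from this have "l \<noteq> m" using that by auto
      ultimately show ?thesis using off by simp
    qed
    then have "(\<Sum>k\<in>UNIV. b k l) = b (\<sigma> l) l" by (subst sum.remove[of _ "\<sigma> l"]) auto
    then show ?thesis using sum1 by simp
  qed
  have "(Y (\<sigma> l) j - Y (\<sigma> l) i) ^ p = (X l j - X l i) ^ p" if "{i, j} \<in> E" for l i j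
    unfolding b[OF that] by (subst sum.remove[of _ l]) (auto simp: off diag)
  then show thesis by (rule that[OF \<open>bij \<sigma>\<close>])
qed

text \<open>
  On each edge the differences of \<open>Y k\<close> and \<open>X l\<close> agree up to a sign, which might vary. But the even powers in the
  coordinated stress do not see the signs, so a stress has the same coordinated
  Laplacian in both. Its kernel contains \<open>Y k\<close> and only affine images of \<open>X l\<close>.
\<close>

lemma coordinates_agree_up_to_sign:
  assumes "\<And>i j. {i, j} \<in> E \<Longrightarrow> (Y k j - Y k i) ^ p = (X l j - X l i) ^ p"
  shows "\<exists>\<alpha> \<beta>. \<bar>\<alpha>\<bar> = 1 \<and> (\<forall>i. Y k i = \<alpha> * X l i + \<beta>)"
proof -
  have abs_eq: "\<bar>Y k j - Y k i\<bar> = \<bar>X l j - X l i\<bar>" if "{i, j} \<in> E" for i j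
  proof -
    have "\<bar>Y k j - Y k i\<bar> ^ p = \<bar>X l j - X l i\<bar> ^ p"
      unfolding power_even_abs[OF even_p] by (rule assms[OF that])
    then show ?thesis by (rule power_eq_imp_eq_base) (use p_pos in auto)
  qed
  have "affine_in (X l) (Y k)"
  proof (rule contact_space)
    fix \<omega> v assume \<omega>: "\<omega> \<in> stresses"
    have "(X l j - X l i) ^ (p - 2) = (Y k j - Y k i) ^ (p - 2)" if "{i, j} \<in> E" for i j
    proof -
      have "even (p - 2)" using even_p by simp
      then show ?thesis using abs_eq[OF that] by (metis power_even_abs)
    qed
    then have "stress_form p E \<omega> (X l) (Y k) v = stress_form p E \<omega> (Y k) (Y k) v"
      unfolding stress_form_def by (intro sum.cong refl) (simp add: neighbours_def)
    then show "stress_form p E \<omega> (X l) (Y k) v = 0" using stress_transfers[OF \<omega>] by simp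
  qed
  then obtain \<alpha> \<beta> where \<alpha>: "\<And>i. Y k i = \<alpha> * X l i + \<beta>" by (auto simp: affine_in_def)
  show ?thesis
  proof (cases "\<exists>i j. i \<noteq> j \<and> {i, j} \<in> E")
    case True
    then obtain i j where ij: "i \<noteq> j" "{i, j} \<in> E" by blast
    have "Y k j - Y k i = \<alpha> * (X l j - X l i)" by (simp add: \<alpha> right_diff_distrib)
    then have "\<bar>\<alpha>\<bar> * \<bar>X l j - X l i\<bar> = \<bar>X l j - X l i\<bar>"
      using abs_eq[OF ij(2)] by (simp add: abs_mult)
    moreover have "X l j - X l i \<noteq> 0" using ij(1) inj_X[of l] by (simp add: inj_eq)
    ultimately have "\<bar>\<alpha>\<bar> = 1" by simp
    then show ?thesis using \<alpha> by blast
  next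
    case False
    \<comment> \<open>without a proper edge all stress forms vanish, and \<open>contact_space\<close> would make
      every vector affine\<close>
    have "affine_in (X l) u" for u
    proof (rule contact_space)
      fix \<omega> v
      have "u j - u i = 0" if "j \<in> neighbours E i" for i j
        using False that by (cases "i = j") (auto simp: neighbours_def)
      then show "stress_form p E \<omega> (X l) u v = 0" by (simp add: stress_form_def)
    qed
    then show ?thesis using ex_not_affine_in[OF three_vertices inj_X] by blast
  qed
qed

end

section \<open>Global rigidity\<close>

lemma lp_isometry_signed_permutation:
  fixes \<tau> :: "'d::finite \<Rightarrow> 'd"
  assumes "even p" "bij \<tau>" "\<And>k. \<bar>\<alpha> k\<bar> = 1"
  shows "lp_isometry p (\<lambda>u. \<chi> k. \<alpha> k * u $ \<tau> k + \<beta> k)" (is "lp_isometry p ?\<iota>")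
  unfolding lp_isometry_def
proof (intro conjI allI)
  show "bij ?\<iota>"
  proof (rule o_bij)
    have sq: "\<alpha> k * \<alpha> k = 1" for k using abs_mult_self_eq[of "\<alpha> k"] assms(3)[of k] by simp
    show "?\<iota> \<circ> (\<lambda>u. \<chi> l. \<alpha> (inv \<tau> l) * (u $ inv \<tau> l - \<beta> (inv \<tau> l))) = id"
      using sq assms(2) by (simp add: fun_eq_iff vec_eq_iff bij_is_inj flip: mult.assoc)
    show "(\<lambda>u. \<chi> l. \<alpha> (inv \<tau> l) * (u $ inv \<tau> l - \<beta> (inv \<tau> l))) \<circ> ?\<iota> = id"
      using sq assms(2) by (simp add: fun_eq_iff vec_eq_iff bij_is_surj surj_f_inv_f flip: mult.assoc)
  qed
  fix u v :: "real ^ 'd"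
  have "(\<alpha> k * u $ \<tau> k + \<beta> k - (\<alpha> k * v $ \<tau> k + \<beta> k)) ^ p = (u $ \<tau> k - v $ \<tau> k) ^ p" for k
  proof -
    have "\<alpha> k * u $ \<tau> k + \<beta> k - (\<alpha> k * v $ \<tau> k + \<beta> k) = \<alpha> k * (u $ \<tau> k - v $ \<tau> k)"
      by (simp add: algebra_simps)
    moreover have "\<alpha> k ^ p = 1" using power_even_abs[OF assms(1), of "\<alpha> k"] assms(3)[of k] by simp
    ultimately show ?thesis by (simp add: power_mult_distrib)
  qed
  then have "(\<Sum>k\<in>UNIV. (?\<iota> u $ k - ?\<iota> v $ k) ^ p) = (\<Sum>k\<in>UNIV. (u $ \<tau> k - v $ \<tau> k) ^ p)"
    by simp
  also have "\<dots> = (\<Sum>k\<in>UNIV. (u $ k - v $ k) ^ p)"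
    by (rule sum.reindex_bij_betw[OF assms(2)])
  finally show "lp_dist p (?\<iota> u) (?\<iota> v) = lp_dist p u v"
    unfolding lp_dist_def by simp
qed

lemma generic_imp_dual_derivations:
  fixes x :: "'v::finite \<Rightarrow> real ^ 'd"
  assumes "generic x"
  obtains \<delta> where "\<And>l i. derivation (\<delta> l i)"
    "\<And>l i m j. \<delta> l i (x j $ m) = (if l = m \<and> i = j then 1 else 0)"
proof -
  have "\<exists>d. derivation d \<and> (\<forall>m j. d (x j $ m) = (if l = m \<and> i = j then 1 else 0))" for l i
  proof -
    obtain d where "derivation d"
      "\<And>c. d (case c of (j, m) \<Rightarrow> x j $ m) = (case c of (j, m) \<Rightarrow> if l = m \<and> i = j then 1 else 0)"
      by (rule algebraically_independent_derivation[OF assms[unfolded generic_def],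
            of "\<lambda>(j, m). if l = m \<and> i = j then 1 else 0"]) blast
    from this(1) this(2)[of "(j, m)" for j m] show ?thesis by auto
  qed
  then obtain \<delta> where "\<And>l i. derivation (\<delta> l i) \<and> (\<forall>m j. \<delta> l i (x j $ m) = (if l = m \<and> i = j then 1 else 0))"
    by metis
  then show thesis using that by blast
qed

text \<open>
  A single stress whose coordinated Laplacian has rank \<open>n - 2\<close> cuts the contact space down to
  the affine images of the coordinate.
\<close>

lemma contact_space_of_coordinated_stress:
  fixes x :: "'v::finite \<Rightarrow> real ^ 'd"
  assumes "even p" "p > 0" "simple_graph E" "CARD('v) \<ge> 2" "inj (\<lambda>i. x i $ k)"
    and "coordinated_self_stress p E x k w" "rank (weighted_laplacian E w) = CARD('v) - 2"
    and u: "\<And>\<omega> v. self_stress p E x \<omega> \<Longrightarrow> stress_form p E \<omega> (\<lambda>i. x i $ k) u v = 0"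
  shows "affine_in (\<lambda>i. x i $ k) u"
proof -
  obtain \<omega> where \<omega>: "self_stress p E x \<omega>"
    and w: "\<And>i j. {i, j} \<in> E \<Longrightarrow> w {i, j} = \<omega> {i, j} * (x j $ k - x i $ k) ^ (p - 2)"
    using assms(6) by (auto simp: coordinated_self_stress_def)
  have balance: "(\<Sum>j\<in>neighbours E i. w {i, j} * (z j - z i)) = 0"
    if "\<forall>v. stress_form p E \<omega> (\<lambda>i. x i $ k) z v = 0" for z i
  proof -
    have "(\<Sum>j\<in>neighbours E i. w {i, j} * (z j - z i)) =
        (\<Sum>j\<in>neighbours E i. \<omega> {i, j} * (x j $ k - x i $ k) ^ (p - 2) * (z j - z i))"
      by (rule sum.cong) (auto simp: w neighbours_def)
    then show ?thesis using that by (simp add: stress_form_eq_0_iff[OF assms(1)])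
  qed
  obtain S :: "'v set" where "card S = 2"
    using assms(4) obtain_subset_with_card_n by blast
  then obtain a b :: 'v where "a \<noteq> b"
    by (auto simp: card_2_iff)
  then have "x a $ k \<noteq> x b $ k" using assms(5) by (auto dest: injD)
  moreover have "\<forall>v. stress_form p E \<omega> (\<lambda>i. x i $ k) (\<lambda>i. x i $ k) v = 0"
    using \<omega> by (simp add: self_stress_iff[OF assms(1,2)])
  moreover have "\<forall>v. stress_form p E \<omega> (\<lambda>i. x i $ k) u v = 0"
    using u[OF \<omega>] by blast
  ultimately show ?thesis
    using laplacian_kernel_affine[OF assms(3,7,4), of "\<lambda>i. x i $ k" a b u] balance by blast
qed

theorem theorem3p6:
  fixes p :: nat
    and E :: "'v::finite set set"
    and x :: "'v \<Rightarrow> real ^ 'd"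
  assumes "even p" and "p > 0" and "p \<noteq> 2"
    and "simple_graph E"
    and "CARD('v) \<ge> 3"
    and "generic x"
    and "\<And>k :: 'd. \<exists>\<omega>. coordinated_self_stress p E x k \<omega> \<and>
           rank (weighted_laplacian E \<omega>) = CARD('v) - 2"
  shows "globally_rigid p E x"
proof -
  define X where "X l i = x i $ l" for l i
  obtain \<delta> where \<delta>: "\<And>l i. derivation (\<delta> l i)"
    "\<And>l i m j. \<delta> l i (X m j) = (if l = m \<and> i = j then 1 else 0)"
    using generic_imp_dual_derivations[OF assms(6)] unfolding X_def by blast
  have inj: "inj (X l)" for l
  proof (rule injI, rule ccontr)
    fix a b assume "X l a = X l b" "a \<noteq> b"
    then show False using \<delta>(2)[of l a l a] \<delta>(2)[of l a l b] by simp
  qed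
  define stresses where "stresses = {\<omega>. \<forall>l v. stress_form p E \<omega> (X l) (X l) v = 0}"
  have stress: "\<omega> \<in> stresses \<longleftrightarrow> self_stress p E x \<omega>" for \<omega>
    unfolding stresses_def X_def self_stress_iff[OF assms(1,2)] by simp
  have contact_space: "affine_in (X l) u"
    if "\<And>\<omega> v. \<omega> \<in> stresses \<Longrightarrow> stress_form p E \<omega> (X l) u v = 0" for l u
  proof -
    obtain w where "coordinated_self_stress p E x l w" "rank (weighted_laplacian E w) = CARD('v) - 2"
      using assms(7) by blast
    then show ?thesis
      using contact_space_of_coordinated_stress[of p E x l w u] assms inj[of l] that
      by (simp add: stress X_def[abs_def])
  qed
  show ?thesis
    unfolding globally_rigid_def
  proof (intro allI impI)
    fix y assume equivalent: "equivalent_frameworks p E x y"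
    define Y where "Y l i = y i $ l" for l i
    have "(\<Sum>k\<in>UNIV. (Y k j - Y k i) ^ p) = (\<Sum>l\<in>UNIV. (X l j - X l i) ^ p)" if "{i, j} \<in> E" for i j
    proof -
      have "root p (\<Sum>l\<in>UNIV. (x j $ l - x i $ l) ^ p) = root p (\<Sum>l\<in>UNIV. (y j $ l - y i $ l) ^ p)"
        using equivalent that unfolding equivalent_frameworks_def lp_dist_def
        by (simp add: insert_commute[of j i])
      then show ?thesis using assms(2) by (simp add: X_def Y_def)
    qed
    then interpret equivalent_framework p E X \<delta> stresses Y
      using assms(1,2,5) \<delta> contact_space
      by unfold_locales (auto simp: stresses_def)
    obtain \<sigma> where \<sigma>: "bij \<sigma>"
      "\<And>l i j. {i, j} \<in> E \<Longrightarrow> (Y (\<sigma> l) j - Y (\<sigma> l) i) ^ p = (X l j - X l i) ^ p"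
      using coordinate_matching by blast
    define \<tau> where "\<tau> = inv \<sigma>"
    have \<tau>: "bij \<tau>" "\<And>k. \<sigma> (\<tau> k) = k"
      using \<sigma>(1) by (simp_all add: \<tau>_def bij_imp_bij_inv bij_is_surj surj_f_inv_f)
    have "\<exists>\<alpha> \<beta>. \<bar>\<alpha>\<bar> = 1 \<and> (\<forall>i. Y k i = \<alpha> * X (\<tau> k) i + \<beta>)" for k
      by (rule coordinates_agree_up_to_sign) (rule \<sigma>(2)[of _ _ "\<tau> k", unfolded \<tau>(2)])
    then have "\<forall>k. \<exists>\<alpha> \<beta>. \<bar>\<alpha>\<bar> = 1 \<and> (\<forall>i. Y k i = \<alpha> * X (\<tau> k) i + \<beta>)"
      by (rule allI)
    then obtain \<alpha> \<beta> where \<alpha>: "\<And>k. \<bar>\<alpha> k\<bar> = 1" and Y: "\<And>k i. Y k i = \<alpha> k * X (\<tau> k) i + \<beta> k"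
      unfolding choice_iff by blast
    show "congruent_frameworks p x y"
      unfolding congruent_frameworks_def
    proof (intro exI conjI allI)
      show "lp_isometry p (\<lambda>u. \<chi> k. \<alpha> k * u $ \<tau> k + \<beta> k)"
        by (rule lp_isometry_signed_permutation[OF assms(1) \<tau>(1) \<alpha>])
      show "y i = (\<chi> k. \<alpha> k * x i $ \<tau> k + \<beta> k)" for i
        using Y[of _ i] by (simp only: vec_eq_iff vec_lambda_beta X_def Y_def) simp
    qed
  qed
qed

end
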